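(* Let $X$ be a countably based topological space and let $\Gamma$ be an arbitrary non-self-dual level of one of the following three hierarchies: the Borel hierarchy, the Hausdorff difference hierarchy over ${\bf\Sigma}^0_\theta$ (for some non-zero $\theta<\omega_1$), or the Luzin projective hierarchy. Then $\Gamma(X)$ has a principal $\Gamma$-total representation.
   Context: A total representation (TR) is any function $\nu$ with domain the Baire space $\mathcal{N}=\omega^\omega$. For TRs $\mu,\nu$, $\mu\leq\nu$ means $\mu=\nu\circ f$ for some continuous $f:\mathcal{N}\to\mathcal{N}$. A family of pointclasses is a family $\Gamma=\{\Gamma(X)\}$ indexed by topological spaces with $\Gamma(X)\subseteq P(X)$ and $f^{-1}(A)\in\Gamma(X)$ for all $A\in\Gamma(Y)$ and continuous $f:X\to Y$. A TR $\nu:\mathcal{N}\to\Gamma(X)$ is a $\Gamma$-TR if its universal set $U_\nu=\{(a,x)\mid x\in\nu(a)\}$ belongs to $\Gamma(\mathcal{N}\times X)$; it is a principal $\Gamma$-TR if it is a $\Gamma$-TR and every $\Gamma$-TR $\mu:\mathcal{N}\to\Gamma(X)$ satisfies $\mu\leq\nu$. The hierarchies, defined in arbitrary spaces $X$: Borel hierarchy: ${\bf\Sigma}^0_0(X)=\{\emptyset\}$, ${\bf\Sigma}^0_1(X)$ is the class of open sets, ${\bf\Sigma}^0_2(X)$ is the class of countable unions of finite Boolean combinations of open sets, and for $\alpha>2$, ${\bf\Sigma}^0_\alpha(X)$ is the class of countable unions of sets in $\bigcup_{\beta<\alpha}{\bf\Pi}^0_\beta(X)$, where ${\bf\Pi}^0_\beta(X)$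 consists of complements of sets in ${\bf\Sigma}^0_\beta(X)$ ($\alpha<\omega_1$). Difference hierarchy: for an ordinal $\alpha$ let $r(\alpha)$ be the parity of the finite part of $\alpha$, $D_\alpha(\{A_\beta\}_{\beta<\alpha})=\bigcup\{A_\beta\setminus\bigcup_{\gamma<\beta}A_\gamma\mid\beta<\alpha,\ r(\beta)\neq r(\alpha)\}$, and ${\bf\Sigma}^{-1,\theta}_\alpha(X)$ is the class of all $D_\alpha(\{A_\beta\}_{\beta<\alpha})$ with all $A_\beta\in{\bf\Sigma}^0_\theta(X)$. Projective hierarchy: ${\bf\Sigma}^1_1(X)$ consists of projections to $X$ of ${\bf\Pi}^0_2$ subsets of $\mathcal{N}\times X$, and ${\bf\Sigma}^1_{n+1}(X)$ consists of projections to $X$ of ${\bf\Pi}^1_n$ subsets of $\mathcal{N}\times X$, where ${\bf\Pi}^1_n$ are complements of ${\bf\Sigma}^1_n$ sets. The non-self-dual levels are the ${\bf\Sigma}$- and ${\bf\Pi}$-levels. *)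

theory Defs
  imports "HOL-Analysis.Analysis" "HOL-Library.Countable_Set_Type"
begin

section \<open>Countable ordinals\<close>

text \<open>
  The type of countable ordinals is the initial well-order of the successor cardinal of
  \<open>\<aleph>\<^sub>0\<close>: it is an uncountable well-order all of whose proper initial segments are countable
  (lemmas below), i.e. it is a copy of \<open>\<omega>\<^sub>1\<close>.
\<close>

typedef omega1 = "Field (cardSuc natLeq)"
  using Field_cardSuc_not_empty[OF natLeq_Card_order] by blast

instantiation omega1 :: wellorder
begin

definition less_eq_omega1 :: "omega1 \<Rightarrow> omega1 \<Rightarrow> bool" where
  "a \<le> b \<longleftrightarrow> (Rep_omega1 a, Rep_omega1 b) \<in> cardSuc natLeq"

definition "less_omega1 (a :: omega1) b \<longleftrightarrow> a \<le> b \<and> a \<noteq> b"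

instance
proof -
  let ?r = "cardSuc natLeq"
  have wo: "Well_order ?r"
    using cardSuc_Card_order[OF natLeq_Card_order] by (simp add: card_order_on_well_order_on)
  then have lo: "Linear_order ?r" and wf: "wf (?r - Id)"
    by (auto simp: well_order_on_def)
  then have refl: "Refl ?r" and trans: "trans ?r" and antisym: "antisym ?r" and tot: "Total ?r"
    by (auto simp: order_on_defs)
  show "OFCLASS(omega1, wellorder_class)"
  proof
    fix x y z :: omega1
    show le_refl: "x \<le> x"
      using refl Rep_omega1[of x] by (auto simp: less_eq_omega1_def refl_on_def)
    show "x \<le> y \<Longrightarrow> y \<le> z \<Longrightarrow> x \<le> z"
      using trans by (auto simp: less_eq_omega1_def trans_def)
    show antis: "x \<le> y \<Longrightarrow> y \<le> x \<Longrightarrow> x = y"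
      using antisymD[OF antisym] by (auto simp: less_eq_omega1_def simp flip: Rep_omega1_inject)
    show "x < y \<longleftrightarrow> x \<le> y \<and> \<not> y \<le> x"
      using antis le_refl by (auto simp: less_omega1_def)
    show "x \<le> y \<or> y \<le> x"
      using tot le_refl Rep_omega1[of x] Rep_omega1[of y] Rep_omega1_inject
      by (auto simp: less_eq_omega1_def total_on_def) metis
  next
    fix P :: "omega1 \<Rightarrow> bool" and a :: omega1
    assume step: "\<And>x. (\<And>y. y < x \<Longrightarrow> P y) \<Longrightarrow> P x"
    have "wf (inv_image (?r - Id) Rep_omega1)"
      using wf by (rule wf_inv_image)
    then show "P a"
    proof (induction a rule: wf_induct_rule)
      case (less x)
      show ?case
        by (rule step, rule less)
          (auto simp: less_omega1_def less_eq_omega1_def Rep_omega1_inject)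
    qed
  qed
qed

end

context
  includes cardinal_syntax
begin

lemma countable_lessThan_omega1: "countable {..<a :: omega1}"
proof -
  have "|underS (cardSuc natLeq) (Rep_omega1 a)| <o cardSuc natLeq"
    by (rule card_of_underS[OF cardSuc_Card_order[OF natLeq_Card_order] Rep_omega1])
  then have "|underS (cardSuc natLeq) (Rep_omega1 a)| \<le>o natLeq"
    by (simp add: cardSuc_ordLeq_ordLess[OF natLeq_Card_order card_of_Card_order])
  then have "countable (underS (cardSuc natLeq) (Rep_omega1 a))"
    using countable_card_le_natLeq by blast
  moreover have "Rep_omega1 ` {..<a} \<subseteq> underS (cardSuc natLeq) (Rep_omega1 a)"
    by (auto simp: underS_def less_omega1_def less_eq_omega1_def Rep_omega1_inject)
  ultimately have "countable (Rep_omega1 ` {..<a})"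
    by (rule countable_subset[rotated])
  then show ?thesis
    by (rule countable_image_inj_on) (auto simp: inj_on_def Rep_omega1_inject)
qed

lemma uncountable_omega1: "uncountable (UNIV :: omega1 set)"
proof
  assume "countable (UNIV :: omega1 set)"
  then have "countable (range Rep_omega1)"
    by simp
  moreover have "range Rep_omega1 = Field (cardSuc natLeq)"
    by (simp add: type_definition.Rep_range[OF type_definition_omega1])
  ultimately have "|Field (cardSuc natLeq)| \<le>o natLeq"
    by (simp add: countable_card_le_natLeq)
  then have "cardSuc natLeq \<le>o natLeq"
    using card_of_Field_ordIso[OF cardSuc_Card_order[OF natLeq_Card_order]]
      ordIso_ordLeq_trans ordIso_symmetric by blast
  then show False
    using cardSuc_greater[OF natLeq_Card_order] not_ordLess_ordLeq by blast
qed

end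

definition ozero :: omega1 where
  "ozero = (LEAST a. True)"

definition osuc :: "omega1 \<Rightarrow> omega1" where
  "osuc a = (LEAST b. a < b)"

text \<open>Every ordinal is uniquely \<open>\<lambda> + n\<close> with \<open>\<lambda>\<close> not a successor and \<open>n\<close> finite.\<close>

definition finite_part :: "omega1 \<Rightarrow> nat" where
  "finite_part a = (THE n. \<exists>l. l \<notin> range osuc \<and> a = (osuc ^^ n) l)"

lemma ozero_le: "ozero \<le> a"
  unfolding ozero_def by (simp add: Least_le)

lemma less_osuc: "a < osuc a"
proof -
  have "\<exists>b. a < b"
  proof (rule ccontr)
    assume "\<not> (\<exists>b. a < b)"
    then have "UNIV = insert a {..<a}"
      by (auto simp: not_less order_le_less)
    then show False
      using uncountable_omega1 countable_lessThan_omega1[of a] by (metis countable_insert)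
  qed
  then show ?thesis
    unfolding osuc_def by (rule LeastI_ex)
qed

lemma less_osuc_iff: "b < osuc a \<longleftrightarrow> b \<le> a"
  using less_osuc[of a] not_less_Least[of b "\<lambda>b. a < b", folded osuc_def] by auto

lemma osuc_inject: "osuc a = osuc b \<longleftrightarrow> a = b"
  by (metis less_osuc_iff antisym order_refl)

lemma finite_part_unique:
  assumes "l \<notin> range osuc" "a = (osuc ^^ n) l"
  shows "finite_part a = n"
  unfolding finite_part_def
proof (rule the_equality)
  show "\<exists>l. l \<notin> range osuc \<and> a = (osuc ^^ n) l"
    using assms by blast
next
  fix m
  assume "\<exists>l. l \<notin> range osuc \<and> a = (osuc ^^ m) l"
  then show "m = n"
    using assms
  proof (induction n arbitrary: a m)
    case 0
    then show ?case by (cases m) auto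
  next
    case (Suc n)
    then show ?case by (cases m) (auto simp: osuc_inject)
  qed
qed

lemma finite_part_limit: "l \<notin> range osuc \<Longrightarrow> finite_part l = 0"
  by (rule finite_part_unique[of l]) auto

lemma finite_part_ex: "\<exists>n l. l \<notin> range osuc \<and> a = (osuc ^^ n) l"
proof (induction a rule: less_induct)
  case (less a)
  show ?case
  proof (cases "a \<in> range osuc")
    case True
    then obtain b where b: "a = osuc b" by blast
    then obtain n l where "l \<notin> range osuc" "b = (osuc ^^ n) l"
      using less less_osuc by blast
    then have "l \<notin> range osuc \<and> a = (osuc ^^ Suc n) l"
      using b by simp
    then show ?thesis by blast
  next
    case False
    then have "a \<notin> range osuc \<and> a = (osuc ^^ 0) a" by simp
    then show ?thesis by blast
  qed
qed

lemma finite_part_osuc: "finite_part (osuc a) = Suc (finite_part a)"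
proof -
  obtain n l where l: "l \<notin> range osuc" "a = (osuc ^^ n) l"
    using finite_part_ex by blast
  moreover from l have "osuc a = (osuc ^^ Suc n) l" by simp
  ultimately show ?thesis
    using finite_part_unique by metis
qed


section \<open>Borel hierarchy\<close>

inductive_set boolean_combinations :: "'a topology \<Rightarrow> 'a set set" for X where
  opn: "openin X U \<Longrightarrow> U \<in> boolean_combinations X"
| compl: "A \<in> boolean_combinations X \<Longrightarrow> topspace X - A \<in> boolean_combinations X"
| union: "A \<in> boolean_combinations X \<Longrightarrow> B \<in> boolean_combinations X \<Longrightarrow>
    A \<union> B \<in> boolean_combinations X"

definition dual_class :: "'a topology \<Rightarrow> 'a set set \<Rightarrow> 'a set set" where
  "dual_class X \<C> = (\<lambda>A. topspace X - A) ` \<C>"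

function sigma0 :: "'a topology \<Rightarrow> omega1 \<Rightarrow> 'a set set" where
  "sigma0 X \<alpha> =
    (if \<alpha> = ozero then {{}}
     else if \<alpha> = osuc ozero then {U. openin X U}
     else if \<alpha> = osuc (osuc ozero) then
       {\<Union>\<A> |\<A>. countable \<A> \<and> \<A> \<subseteq> boolean_combinations X}
     else {\<Union>\<A> |\<A>. countable \<A> \<and> \<A> \<subseteq> (\<Union>\<beta>\<in>{..<\<alpha>}. dual_class X (sigma0 X \<beta>))})"
  by pat_completeness auto
termination
  by (relation "{((Y, a), (X, b)). Y = X \<and> a < b}")
    (auto intro: wf_subset[OF wf_inv_image[OF wf, of snd]])

declare sigma0.simps [simp del]

definition pi0 :: "'a topology \<Rightarrow> omega1 \<Rightarrow> 'a set set" where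
  "pi0 X \<alpha> = dual_class X (sigma0 X \<alpha>)"


section \<open>Difference hierarchies\<close>

definition difference_op :: "omega1 \<Rightarrow> (omega1 \<Rightarrow> 'a set) \<Rightarrow> 'a set" where
  "difference_op \<alpha> A =
    (\<Union>\<beta>\<in>{\<beta>. \<beta> < \<alpha> \<and> finite_part \<beta> mod 2 \<noteq> finite_part \<alpha> mod 2}. A \<beta> - (\<Union>\<gamma>\<in>{..<\<beta>}. A \<gamma>))"

definition sigma_diff :: "'a topology \<Rightarrow> omega1 \<Rightarrow> omega1 \<Rightarrow> 'a set set" where
  "sigma_diff X \<theta> \<alpha> = {difference_op \<alpha> A |A. \<forall>\<beta><\<alpha>. A \<beta> \<in> sigma0 X \<theta>}"


section \<open>Projective hierarchy\<close>

abbreviation baire :: "(nat \<Rightarrow> nat) topology" where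
  "baire \<equiv> euclidean"

lemma baire_eq_product: "baire = product_topology (\<lambda>_. discrete_topology UNIV) UNIV"
  by (metis euclidean_product_topology discrete_topology_unique_alt topspace_euclidean
      open_discrete open_openin subset_UNIV)

text \<open>
  The definition of \<open>\<Sigma>\<^sup>1\<^sub>n\<close> of a space over the points \<open>'a\<close> refers to a lower level of a space over
  the points \<open>(nat \<Rightarrow> nat) \<times> 'a\<close>, a recursion through different types. It is carried out on the
  single type \<open>(nat \<Rightarrow> nat) list \<times> 'a\<close>, closed up to homeomorphism under products with
  the Baire space: \<open>baire_times T\<close> is \<open>baire \<times> T\<close> with \<open>(b, (bs, x))\<close> written as \<open>(b # bs, x)\<close>.
  Lemmas \<open>sigma1_one\<close> and \<open>sigma1_Suc\<close> below recover the intended recursion for all spaces.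
\<close>

definition uncons :: "(nat \<Rightarrow> nat) list \<times> 'a \<Rightarrow> (nat \<Rightarrow> nat) \<times> (nat \<Rightarrow> nat) list \<times> 'a" where
  "uncons p = (hd (fst p), (tl (fst p), snd p))"

definition baire_times ::
    "((nat \<Rightarrow> nat) list \<times> 'a) topology \<Rightarrow> ((nat \<Rightarrow> nat) list \<times> 'a) topology" where
  "baire_times T = pullback_topology {p. fst p \<noteq> []} uncons (prod_topology baire T)"

definition base_space :: "'a topology \<Rightarrow> ((nat \<Rightarrow> nat) list \<times> 'a) topology" where
  "base_space X = pullback_topology {p. fst p = []} snd X"

text \<open>The first level has index 1; index 0 is unused.\<close>

fun sigma1_list ::
    "nat \<Rightarrow> ((nat \<Rightarrow> nat) list \<times> 'a) topology \<Rightarrow> ((nat \<Rightarrow> nat) list \<times> 'a) set set" where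
  "sigma1_list 0 T = {}"
| "sigma1_list (Suc 0) T = (\<lambda>B. (snd \<circ> uncons) ` B) ` pi0 (baire_times T) (osuc (osuc ozero))"
| "sigma1_list (Suc (Suc n)) T =
    (\<lambda>B. (snd \<circ> uncons) ` B) ` dual_class (baire_times T) (sigma1_list (Suc n) (baire_times T))"

definition sigma1 :: "'a topology \<Rightarrow> nat \<Rightarrow> 'a set set" where
  "sigma1 X n = {A. Pair [] ` A \<in> sigma1_list n (base_space X)}"

definition pi1 :: "'a topology \<Rightarrow> nat \<Rightarrow> 'a set set" where
  "pi1 X n = dual_class X (sigma1 X n)"

lemma boolean_combinations_preimage:
  assumes f: "continuous_map X Y f" and "A \<in> boolean_combinations Y"
  shows "topspace X \<inter> f -` A \<in> boolean_combinations X"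
  using assms(2)
proof induction
  case (opn U)
  then have "openin X {x \<in> topspace X. f x \<in> U}"
    using f by (simp add: continuous_map_def)
  moreover have "{x \<in> topspace X. f x \<in> U} = topspace X \<inter> f -` U" by auto
  ultimately show ?case by (metis boolean_combinations.opn)
next
  case (compl A)
  have "topspace X \<inter> f -` (topspace Y - A) = topspace X - (topspace X \<inter> f -` A)"
    using f by (auto simp: continuous_map_def)
  then show ?case using compl boolean_combinations.compl by metis
next
  case (union A B)
  have "topspace X \<inter> f -` (A \<union> B) = (topspace X \<inter> f -` A) \<union> (topspace X \<inter> f -` B)"
    by auto
  then show ?case using union boolean_combinations.union by metis
qed

lemma dual_class_preimage:
  assumes f: "continuous_map X Y f" and A: "A \<in> dual_class Y \<D>"
    and pre: "\<And>B. B \<in> \<D> \<Longrightarrow> topspace X \<inter> f -` B \<in> \<C>"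
  shows "topspace X \<inter> f -` A \<in> dual_class X \<C>"
proof -
  obtain B where B: "B \<in> \<D>" "A = topspace Y - B"
    using A by (auto simp: dual_class_def)
  then have "topspace X \<inter> f -` A = topspace X - (topspace X \<inter> f -` B)"
    using f by (auto simp: continuous_map_def)
  then show ?thesis
    using pre[OF B(1)] by (auto simp: dual_class_def)
qed

lemma Union_preimage:
  assumes "countable \<A>" "\<A> \<subseteq> \<D>" and pre: "\<And>B. B \<in> \<D> \<Longrightarrow> S \<inter> f -` B \<in> \<C>"
  shows "S \<inter> f -` (\<Union>\<A>) \<in> {\<Union>\<A> |\<A>. countable \<A> \<and> \<A> \<subseteq> \<C>}"
proof -
  have "S \<inter> f -` (\<Union>\<A>) = \<Union>((\<lambda>B. S \<inter> f -` B) ` \<A>)" by auto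
  moreover have "countable ((\<lambda>B. S \<inter> f -` B) ` \<A>)" "(\<lambda>B. S \<inter> f -` B) ` \<A> \<subseteq> \<C>"
    using assms by auto
  ultimately show ?thesis by blast
qed

lemma sigma0_preimage:
  assumes f: "continuous_map X Y f"
  shows "A \<in> sigma0 Y \<alpha> \<Longrightarrow> topspace X \<inter> f -` A \<in> sigma0 X \<alpha>"
proof (induction \<alpha> arbitrary: A rule: less_induct)
  case (less \<alpha>)
  consider "\<alpha> = ozero" | "\<alpha> \<noteq> ozero" "\<alpha> = osuc ozero"
    | "\<alpha> \<noteq> ozero" "\<alpha> \<noteq> osuc ozero" "\<alpha> = osuc (osuc ozero)"
    | (big) "\<alpha> \<noteq> ozero" "\<alpha> \<noteq> osuc ozero" "\<alpha> \<noteq> osuc (osuc ozero)"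
    by blast
  then show ?case
  proof cases
    case 1
    then show ?thesis using less.prems by (simp add: sigma0.simps)
  next
    case 2
    then have "openin X {x \<in> topspace X. f x \<in> A}"
      using f less.prems by (simp add: continuous_map_def sigma0.simps)
    moreover have "{x \<in> topspace X. f x \<in> A} = topspace X \<inter> f -` A" by auto
    ultimately show ?thesis using 2 by (simp add: sigma0.simps)
  next
    case 3
    then have "A \<in> {\<Union>\<A> |\<A>. countable \<A> \<and> \<A> \<subseteq> boolean_combinations Y}"
      using less.prems by (subst (asm) sigma0.simps) simp
    then obtain \<A> where \<A>: "countable \<A>" "\<A> \<subseteq> boolean_combinations Y" "A = \<Union>\<A>" by blast
    have "topspace X \<inter> f -` A \<in> {\<Union>\<A> |\<A>. countable \<A> \<and> \<A> \<subseteq> boolean_combinations X}"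
      unfolding \<A>(3) by (rule Union_preimage[OF \<A>(1,2) boolean_combinations_preimage[OF f]])
    then show ?thesis using 3 by (subst sigma0.simps) simp
  next
    case big
    let ?D = "\<lambda>Z. \<Union>\<beta>\<in>{..<\<alpha>}. dual_class Z (sigma0 Z \<beta>)"
    have "A \<in> {\<Union>\<A> |\<A>. countable \<A> \<and> \<A> \<subseteq> ?D Y}"
      using less.prems big by (subst (asm) sigma0.simps) simp
    then obtain \<A> where \<A>: "countable \<A>" "\<A> \<subseteq> ?D Y" "A = \<Union>\<A>" by blast
    have "topspace X \<inter> f -` B \<in> ?D X" if "B \<in> ?D Y" for B
      using that dual_class_preimage[OF f] less.IH by blast
    then have "topspace X \<inter> f -` A \<in> {\<Union>\<A> |\<A>. countable \<A> \<and> \<A> \<subseteq> ?D X}"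
      unfolding \<A>(3) by (rule Union_preimage[OF \<A>(1,2)])
    then show ?thesis using big by (subst sigma0.simps) simp
  qed
qed

lemma pi0_preimage:
  "continuous_map X Y f \<Longrightarrow> A \<in> pi0 Y \<alpha> \<Longrightarrow> topspace X \<inter> f -` A \<in> pi0 X \<alpha>"
  unfolding pi0_def using dual_class_preimage sigma0_preimage by metis

lemma topspace_baire_times:
  "p \<in> topspace (baire_times T) \<longleftrightarrow> fst p \<noteq> [] \<and> snd (uncons p) \<in> topspace T"
  by (auto simp: baire_times_def topspace_pullback_topology uncons_def)

lemma topspace_base_space: "p \<in> topspace (base_space X) \<longleftrightarrow> fst p = [] \<and> snd p \<in> topspace X"
  by (auto simp: base_space_def topspace_pullback_topology)

lemma continuous_map_uncons: "continuous_map (baire_times T) (prod_topology baire T) uncons"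
  unfolding baire_times_def using continuous_map_pullback[OF continuous_map_id] by simp

lemma continuous_map_snd_base: "continuous_map (base_space X) X snd"
  unfolding base_space_def using continuous_map_pullback[OF continuous_map_id] by simp

lemma continuous_map_into_baire_times:
  assumes "continuous_map S baire f" "continuous_map S T g"
  shows "continuous_map S (baire_times T) (\<lambda>x. (f x # fst (g x), snd (g x)))"
  unfolding baire_times_def
  by (rule continuous_map_pullback')
    (use assms in \<open>auto simp: o_def uncons_def continuous_map_pairwise\<close>)

lemma continuous_map_into_base:
  assumes "continuous_map S X g"
  shows "continuous_map S (base_space X) (\<lambda>x. ([], g x))"
  unfolding base_space_def
  by (rule continuous_map_pullback') (use assms in \<open>auto simp: o_def\<close>)

lemma projection_preimage:
  assumes f: "continuous_map S T f"
  obtains g where "continuous_map (baire_times S) (baire_times T) g"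
    and "\<And>B. B \<subseteq> topspace (baire_times T) \<Longrightarrow> topspace S \<inter> f -` ((snd \<circ> uncons) ` B) =
      (snd \<circ> uncons) ` (topspace (baire_times S) \<inter> g -` B)"
proof
  let ?g = "\<lambda>p. (fst (uncons p) # fst (f (snd (uncons p))), snd (f (snd (uncons p))))"
  have "continuous_map (baire_times S) baire (\<lambda>p. fst (uncons p))"
    "continuous_map (baire_times S) T (\<lambda>p. f (snd (uncons p)))"
    using continuous_map_compose[OF continuous_map_uncons[of S] continuous_map_fst]
      continuous_map_compose[OF continuous_map_compose[OF continuous_map_uncons[of S] continuous_map_snd] f]
    by (auto simp: o_def)
  then show "continuous_map (baire_times S) (baire_times T) ?g"
    by (rule continuous_map_into_baire_times)
  fix B assume B: "B \<subseteq> topspace (baire_times T)"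
  show "topspace S \<inter> f -` ((snd \<circ> uncons) ` B) =
      (snd \<circ> uncons) ` (topspace (baire_times S) \<inter> ?g -` B)" (is "?L = ?R")
  proof
    show "?L \<subseteq> ?R"
    proof
      fix x assume "x \<in> ?L"
      then obtain p where p: "p \<in> B" "f x = snd (uncons p)" and x: "x \<in> topspace S" by auto
      have ne: "fst p \<noteq> []" using p B topspace_baire_times by blast
      let ?q = "(hd (fst p) # fst x, snd x)"
      have "?g ?q = p"
        using p ne by (cases p) (auto simp: uncons_def)
      then have "?q \<in> topspace (baire_times S) \<inter> ?g -` B"
        using x p by (auto simp: topspace_baire_times uncons_def)
      moreover have "(snd \<circ> uncons) ?q = x" by (simp add: uncons_def)
      ultimately show "x \<in> ?R" by (intro image_eqI[of _ _ ?q]) auto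
    qed
    show "?R \<subseteq> ?L"
    proof
      fix x assume "x \<in> ?R"
      then obtain q where q: "q \<in> topspace (baire_times S)" "?g q \<in> B" "x = snd (uncons q)"
        by auto
      have "snd (uncons (?g q)) = f x"
        using q by (simp add: uncons_def)
      then have "f x \<in> (snd \<circ> uncons) ` B"
        using q(2) by (metis comp_apply image_eqI)
      then show "x \<in> ?L"
        using q by (auto simp: topspace_baire_times)
    qed
  qed
qed

lemma dual_class_subset: "A \<in> dual_class X \<C> \<Longrightarrow> A \<subseteq> topspace X"
  by (auto simp: dual_class_def)

lemma sigma1_list_preimage:
  fixes S :: "((nat \<Rightarrow> nat) list \<times> 'a) topology" and T :: "((nat \<Rightarrow> nat) list \<times> 'b) topology"
  assumes "continuous_map S T f" "A \<in> sigma1_list n T"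
  shows "topspace S \<inter> f -` A \<in> sigma1_list n S"
  using assms
proof (induction n T arbitrary: S f A rule: sigma1_list.induct)
  case (1 T)
  then show ?case by simp
next
  case (2 T)
  obtain g where g: "continuous_map (baire_times S) (baire_times T) g"
    and eq: "\<And>B. B \<subseteq> topspace (baire_times T) \<Longrightarrow> topspace S \<inter> f -` ((snd \<circ> uncons) ` B) =
      (snd \<circ> uncons) ` (topspace (baire_times S) \<inter> g -` B)"
    using projection_preimage[OF 2(1)] by blast
  obtain B where B: "B \<in> pi0 (baire_times T) (osuc (osuc ozero))" "A = (snd \<circ> uncons) ` B"
    using 2(2) by auto
  then have "B \<subseteq> topspace (baire_times T)"
    using dual_class_subset by (auto simp: pi0_def)
  then show ?case
    using eq B pi0_preimage[OF g B(1)] by auto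
next
  case (3 n T)
  obtain g where g: "continuous_map (baire_times S) (baire_times T) g"
    and eq: "\<And>B. B \<subseteq> topspace (baire_times T) \<Longrightarrow> topspace S \<inter> f -` ((snd \<circ> uncons) ` B) =
      (snd \<circ> uncons) ` (topspace (baire_times S) \<inter> g -` B)"
    using projection_preimage[OF 3(2)] by blast
  obtain B where B: "B \<in> dual_class (baire_times T) (sigma1_list (Suc n) (baire_times T))"
    "A = (snd \<circ> uncons) ` B"
    using 3(3) by auto
  have "topspace (baire_times S) \<inter> g -` B
      \<in> dual_class (baire_times S) (sigma1_list (Suc n) (baire_times S))"
    using dual_class_preimage[OF g B(1)] 3(1)[OF g] by blast
  then show ?case
    using eq[OF dual_class_subset[OF B(1)]] B(2) by auto
qed

lemma sigma1_preimage:
  assumes f: "continuous_map X Y f" and A: "A \<in> sigma1 Y n"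
  shows "topspace X \<inter> f -` A \<in> sigma1 X n"
proof -
  have "continuous_map (base_space X) (base_space Y) (\<lambda>p. ([], f (snd p)))"
    using continuous_map_into_base continuous_map_compose[OF continuous_map_snd_base f]
    by (auto simp: o_def)
  from sigma1_list_preimage[OF this A[unfolded sigma1_def, simplified]]
  have "topspace (base_space X) \<inter> (\<lambda>p. ([] :: (nat \<Rightarrow> nat) list, f (snd p))) -` Pair [] ` A
      \<in> sigma1_list n (base_space X)" .
  moreover have "topspace (base_space X) \<inter> (\<lambda>p. ([] :: (nat \<Rightarrow> nat) list, f (snd p))) -` Pair [] ` A
      = Pair [] ` (topspace X \<inter> f -` A)"
    by (auto simp: topspace_base_space)
  ultimately show ?thesis by (simp add: sigma1_def)
qed

lemma baire_times_base_homeo: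
  fixes X :: "'a topology"
  assumes h_def: "h = (\<lambda>p :: (nat \<Rightarrow> nat) \<times> 'a. ([fst p], snd p))"
    and k_def: "k = (\<lambda>q :: (nat \<Rightarrow> nat) list \<times> 'a. (hd (fst q), snd q))"
  shows "continuous_map (prod_topology baire X) (baire_times (base_space X)) h"
    and "continuous_map (baire_times (base_space X)) (prod_topology baire X) k"
    and "q \<in> topspace (baire_times (base_space X)) \<Longrightarrow> h (k q) = q"
    and "h p \<in> topspace (baire_times (base_space X)) \<longleftrightarrow> p \<in> topspace (prod_topology baire X)"
proof -
  show "continuous_map (prod_topology baire X) (baire_times (base_space X)) h"
    using continuous_map_into_baire_times[OF continuous_map_fst[of baire X]
        continuous_map_into_base[OF continuous_map_snd[of baire X]]]
    by (simp add: h_def)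
  have "continuous_map (baire_times (base_space X)) baire (fst \<circ> uncons)"
    "continuous_map (baire_times (base_space X)) X (snd \<circ> (snd \<circ> uncons))"
    using continuous_map_compose[OF continuous_map_uncons continuous_map_fst]
      continuous_map_compose[OF continuous_map_compose[OF continuous_map_uncons continuous_map_snd]
        continuous_map_snd_base] by auto
  then show "continuous_map (baire_times (base_space X)) (prod_topology baire X) k"
    by (simp add: continuous_map_pairwise k_def o_def uncons_def)
  show "q \<in> topspace (baire_times (base_space X)) \<Longrightarrow> h (k q) = q"
    by (cases q; cases "fst q")
      (auto simp: topspace_baire_times topspace_base_space uncons_def h_def k_def)
  show "h p \<in> topspace (baire_times (base_space X)) \<longleftrightarrow> p \<in> topspace (prod_topology baire X)"
    by (cases p) (auto simp: topspace_baire_times topspace_base_space uncons_def h_def)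
qed

lemma projection_transfer:
  fixes X :: "'a topology"
  assumes sub: "\<And>B. B \<in> \<C> \<Longrightarrow> B \<subseteq> topspace (baire_times (base_space X))"
    and sub': "\<And>B. B \<in> \<D> \<Longrightarrow> B \<subseteq> topspace (prod_topology baire X)"
    and CD: "\<And>B g. B \<in> \<C> \<Longrightarrow> continuous_map (prod_topology baire X) (baire_times (base_space X)) g
      \<Longrightarrow> topspace (prod_topology baire X) \<inter> g -` B \<in> \<D>"
    and DC: "\<And>B g. B \<in> \<D> \<Longrightarrow> continuous_map (baire_times (base_space X)) (prod_topology baire X) g
      \<Longrightarrow> topspace (baire_times (base_space X)) \<inter> g -` B \<in> \<C>"
  shows "{A. Pair [] ` A \<in> (\<lambda>B. (snd \<circ> uncons) ` B) ` \<C>} = {snd ` B |B. B \<in> \<D>}"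
proof -
  define h where "h = (\<lambda>p :: (nat \<Rightarrow> nat) \<times> 'a. ([fst p], snd p))"
  define k where "k = (\<lambda>q :: (nat \<Rightarrow> nat) list \<times> 'a. (hd (fst q), snd q))"
  let ?N = "prod_topology baire X" and ?L = "baire_times (base_space X)"
  note hk = baire_times_base_homeo[OF h_def k_def, where X = X]
  have kh: "k (h p) = p" and sh: "snd (uncons (h p)) = ([], snd p)" for p
    by (simp_all add: h_def k_def uncons_def)
  show ?thesis
  proof (intro set_eqI iffI)
    fix A assume "A \<in> {A. Pair [] ` A \<in> (\<lambda>B. (snd \<circ> uncons) ` B) ` \<C>}"
    then obtain B where B: "B \<in> \<C>" "Pair [] ` A = (snd \<circ> uncons) ` B" by auto
    have Beq: "B = h ` (topspace ?N \<inter> h -` B)"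
    proof (intro equalityI subsetI)
      fix q assume q: "q \<in> B"
      then have "h (k q) = q" by (intro hk(3) subsetD[OF sub[OF B(1)]])
      moreover from this have "k q \<in> topspace ?N"
        using hk(4)[of "k q"] subsetD[OF sub[OF B(1)] q] by simp
      ultimately show "q \<in> h ` (topspace ?N \<inter> h -` B)"
        using q by (intro image_eqI[of _ _ "k q"]) (simp_all del: topspace_prod_topology)
    next
      fix q assume "q \<in> h ` (topspace ?N \<inter> h -` B)"
      then show "q \<in> B" by blast
    qed
    have "Pair [] ` A = (\<lambda>p. snd (uncons (h p))) ` (topspace ?N \<inter> h -` B)"
      using arg_cong[OF Beq, of "\<lambda>B. (snd \<circ> uncons) ` B"] by (simp only: B(2) image_image o_apply)
    also have "\<dots> = Pair [] ` (snd ` (topspace ?N \<inter> h -` B))"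
      by (simp add: sh image_image)
    finally have "A = snd ` (topspace ?N \<inter> h -` B)"
      by (simp add: inj_image_eq_iff inj_def)
    then show "A \<in> {snd ` B |B. B \<in> \<D>}"
      using CD[OF B(1) hk(1)] by blast
  next
    fix A assume "A \<in> {snd ` B |B. B \<in> \<D>}"
    then obtain B where B: "B \<in> \<D>" "A = snd ` B" by blast
    let ?C = "topspace ?L \<inter> k -` B"
    have Ceq: "?C = h ` B"
    proof (intro equalityI subsetI)
      fix q assume "q \<in> ?C"
      then show "q \<in> h ` B" using hk(3)[of q] by (intro image_eqI[of _ _ "k q"]) auto
    next
      fix q assume "q \<in> h ` B"
      then obtain p where p: "p \<in> B" "q = h p" by blast
      moreover have "q \<in> topspace ?L"
        using subsetD[OF sub'[OF B(1)] p(1)] hk(4)[of p] p(2) by simp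
      ultimately show "q \<in> ?C" by (simp add: kh)
    qed
    have "(snd \<circ> uncons) ` ?C = (\<lambda>p. snd (uncons (h p))) ` B"
      unfolding Ceq by (simp add: image_image)
    also have "\<dots> = Pair [] ` A"
      by (simp add: sh image_image B(2))
    finally have "Pair [] ` A = (snd \<circ> uncons) ` ?C" by simp
    then show "A \<in> {A. Pair [] ` A \<in> (\<lambda>B. (snd \<circ> uncons) ` B) ` \<C>}"
      using DC[OF B(1) hk(2)] by blast
  qed
qed

lemma sigma1_one: "sigma1 X 1 = {snd ` B |B. B \<in> pi0 (prod_topology baire X) (osuc (osuc ozero))}"
  unfolding sigma1_def One_nat_def sigma1_list.simps
  by (rule projection_transfer; (rule pi0_preimage)?)
    (simp_all only: pi0_def dual_class_subset)

lemma sigma1_list_homeo_iff: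
  fixes X :: "'a topology"
  shows "B \<in> sigma1 (prod_topology baire X) n \<Longrightarrow>
      continuous_map (baire_times (base_space X)) (prod_topology baire X) g \<Longrightarrow>
      topspace (baire_times (base_space X)) \<inter> g -` B \<in> sigma1_list n (baire_times (base_space X))"
    and "C \<in> sigma1_list n (baire_times (base_space X)) \<Longrightarrow>
      continuous_map (prod_topology baire X) (baire_times (base_space X)) g' \<Longrightarrow>
      topspace (prod_topology baire X) \<inter> g' -` C \<in> sigma1 (prod_topology baire X) n"
proof -
  let ?N = "prod_topology baire X" and ?L = "baire_times (base_space X)"
  assume B: "B \<in> sigma1 ?N n" and g: "continuous_map ?L ?N g"
  have "topspace ?L \<inter> (\<lambda>x. ([] :: (nat \<Rightarrow> nat) list, g x)) -` (Pair [] ` B) \<in> sigma1_list n ?L"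
    by (rule sigma1_list_preimage[OF continuous_map_into_base[OF g]])
      (use B in \<open>simp add: sigma1_def\<close>)
  moreover have "(\<lambda>x. ([] :: (nat \<Rightarrow> nat) list, g x)) -` (Pair [] ` B) = g -` B" by auto
  ultimately show "topspace ?L \<inter> g -` B \<in> sigma1_list n ?L" by simp
next
  let ?N = "prod_topology baire X" and ?L = "baire_times (base_space X)"
  assume C: "C \<in> sigma1_list n ?L" and g: "continuous_map ?N ?L g'"
  have "topspace (base_space ?N) \<inter> (g' \<circ> snd) -` C \<in> sigma1_list n (base_space ?N)"
    by (rule sigma1_list_preimage[OF continuous_map_compose[OF continuous_map_snd_base g] C])
  moreover have "topspace (base_space ?N) \<inter> (g' \<circ> snd) -` C = Pair [] ` (topspace ?N \<inter> g' -` C)"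
    by (auto simp: topspace_base_space image_iff simp del: topspace_prod_topology)
  ultimately show "topspace ?N \<inter> g' -` C \<in> sigma1 ?N n"
    by (simp add: sigma1_def)
qed

lemma sigma1_Suc:
  assumes "n \<ge> 1"
  shows "sigma1 X (Suc n) = {snd ` B |B. B \<in> pi1 (prod_topology baire X) n}"
proof -
  let ?N = "prod_topology baire X" and ?L = "baire_times (base_space X)"
  obtain m where m: "n = Suc m" using assms by (cases n) auto
  have "{A. Pair [] ` A \<in> (\<lambda>B. (snd \<circ> uncons) ` B) ` dual_class ?L (sigma1_list n ?L)}
      = {snd ` B |B. B \<in> dual_class ?N (sigma1 ?N n)}"
  proof (rule projection_transfer)
    fix B g
    assume B: "B \<in> dual_class ?L (sigma1_list n ?L)" and g: "continuous_map ?N ?L g"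
    show "topspace ?N \<inter> g -` B \<in> dual_class ?N (sigma1 ?N n)"
      by (rule dual_class_preimage[OF g B sigma1_list_homeo_iff(2)[OF _ g]])
  next
    fix B g
    assume B: "B \<in> dual_class ?N (sigma1 ?N n)" and g: "continuous_map ?L ?N g"
    show "topspace ?L \<inter> g -` B \<in> dual_class ?L (sigma1_list n ?L)"
      by (rule dual_class_preimage[OF g B sigma1_list_homeo_iff(1)[OF _ g]])
  qed (rule dual_class_subset; assumption)+
  then show ?thesis by (simp add: sigma1_def pi1_def m)
qed


section \<open>Levels and total representations\<close>

text \<open>
  The levels are given by codes, since one level determines a pointclass in spaces over
  different types.
\<close>

datatype level =
    Borel_Sigma omega1
  | Borel_Pi omega1
  | Difference_Sigma omega1 omega1
  | Difference_Pi omega1 omega1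
  | Luzin_Sigma nat
  | Luzin_Pi nat

fun is_level :: "level \<Rightarrow> bool" where
  "is_level (Borel_Sigma \<alpha>) = True"
| "is_level (Borel_Pi \<alpha>) = True"
| "is_level (Difference_Sigma \<theta> \<alpha>) = (\<theta> \<noteq> ozero)"
| "is_level (Difference_Pi \<theta> \<alpha>) = (\<theta> \<noteq> ozero)"
| "is_level (Luzin_Sigma n) = (n \<ge> 1)"
| "is_level (Luzin_Pi n) = (n \<ge> 1)"

fun pointclass :: "level \<Rightarrow> 'a topology \<Rightarrow> 'a set set" where
  "pointclass (Borel_Sigma \<alpha>) X = sigma0 X \<alpha>"
| "pointclass (Borel_Pi \<alpha>) X = pi0 X \<alpha>"
| "pointclass (Difference_Sigma \<theta> \<alpha>) X = sigma_diff X \<theta> \<alpha>"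
| "pointclass (Difference_Pi \<theta> \<alpha>) X = dual_class X (sigma_diff X \<theta> \<alpha>)"
| "pointclass (Luzin_Sigma n) X = sigma1 X n"
| "pointclass (Luzin_Pi n) X = pi1 X n"

lemma sigma_diff_preimage:
  assumes f: "continuous_map X Y f" and "A \<in> sigma_diff Y \<theta> \<alpha>"
  shows "topspace X \<inter> f -` A \<in> sigma_diff X \<theta> \<alpha>"
proof -
  obtain B where B: "A = difference_op \<alpha> B" "\<forall>\<beta><\<alpha>. B \<beta> \<in> sigma0 Y \<theta>"
    using assms(2) by (auto simp: sigma_diff_def)
  have "topspace X \<inter> f -` A = difference_op \<alpha> (\<lambda>\<beta>. topspace X \<inter> f -` B \<beta>)"
    unfolding B(1) difference_op_def by blast
  moreover have "\<forall>\<beta><\<alpha>. topspace X \<inter> f -` B \<beta> \<in> sigma0 X \<theta>"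
    using B(2) sigma0_preimage[OF f] by blast
  ultimately show ?thesis
    unfolding sigma_diff_def by blast
qed

lemma pointclass_preimage:
  assumes f: "continuous_map X Y f" and A: "A \<in> pointclass \<Gamma> Y"
  shows "topspace X \<inter> f -` A \<in> pointclass \<Gamma> X"
  using A sigma0_preimage[OF f] pi0_preimage[OF f] sigma_diff_preimage[OF f] sigma1_preimage[OF f]
    dual_class_preimage[OF f _ sigma_diff_preimage[OF f]]
    dual_class_preimage[OF f _ sigma1_preimage[OF f]]
  by (cases \<Gamma>) (simp_all add: pi1_def)

definition tr_reducible :: "((nat \<Rightarrow> nat) \<Rightarrow> 'b) \<Rightarrow> ((nat \<Rightarrow> nat) \<Rightarrow> 'b) \<Rightarrow> bool" where
  "tr_reducible \<mu> \<nu> \<longleftrightarrow> (\<exists>f. continuous_map baire baire f \<and> \<mu> = \<nu> \<circ> f)"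

definition universal_set :: "((nat \<Rightarrow> nat) \<Rightarrow> 'a set) \<Rightarrow> ((nat \<Rightarrow> nat) \<times> 'a) set" where
  "universal_set \<nu> = {(a, x). x \<in> \<nu> a}"

definition total_representation :: "level \<Rightarrow> 'a topology \<Rightarrow> ((nat \<Rightarrow> nat) \<Rightarrow> 'a set) \<Rightarrow> bool" where
  "total_representation \<Gamma> X \<nu> \<longleftrightarrow>
    range \<nu> \<subseteq> pointclass \<Gamma> X \<and> universal_set \<nu> \<in> pointclass \<Gamma> (prod_topology baire X)"

definition principal_total_representation ::
    "level \<Rightarrow> 'a topology \<Rightarrow> ((nat \<Rightarrow> nat) \<Rightarrow> 'a set) \<Rightarrow> bool" where
  "principal_total_representation \<Gamma> X \<nu> \<longleftrightarrow>
    total_representation \<Gamma> X \<nu> \<and> (\<forall>\<mu>. total_representation \<Gamma> X \<mu> \<longrightarrow> tr_reducible \<mu> \<nu>)"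

end

theory Submission
  imports Defs
begin

text \<open>
  A set universal for \<open>\<Gamma>(baire \<times> X)\<close> yields a principal representation of \<open>\<Gamma>(X)\<close>: split the code
  into a pair \<open>(b, c)\<close> and take the section of the universal set at \<open>b\<close> and then at \<open>c\<close>. If \<open>b\<close>
  codes the universal set of a given representation \<open>\<mu>\<close>, then \<open>c \<mapsto> (b, c)\<close> reduces \<open>\<mu>\<close>.
  Universal sets for all second countable spaces arise from a countable base by countably many
  set operations, complements and projections, applied with a code split into countably many codes.
\<close>

section \<open>Pointclasses\<close>

lemma boolean_combinations_subset: "A \<in> boolean_combinations X \<Longrightarrow> A \<subseteq> topspace X"
  by (induction rule: boolean_combinations.induct) (auto dest: openin_subset)

lemma sigma0_subset: "A \<in> sigma0 X \<alpha> \<Longrightarrow> A \<subseteq> topspace X"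
  using boolean_combinations_subset[of _ X] dual_class_subset[of _ X]
  by (subst (asm) sigma0.simps) (auto split: if_splits dest: openin_subset, blast+)

lemma sigma1_subset:
  assumes "A \<in> sigma1 X n"
  shows "A \<subseteq> topspace X"
proof (cases n)
  case 0
  then show ?thesis using assms by (simp add: sigma1_def)
next
  case (Suc m)
  have "\<exists>B. A = snd ` B \<and> B \<subseteq> topspace (prod_topology baire X)"
  proof (cases m)
    case 0
    then show ?thesis
      using assms Suc sigma1_one[of X] dual_class_subset[of _ "prod_topology baire X"]
      by (auto simp: pi0_def simp del: topspace_prod_topology) blast
  next
    case (Suc k)
    then show ?thesis
      using assms \<open>n = Suc m\<close> sigma1_Suc[of m X] dual_class_subset[of _ "prod_topology baire X"]
      by (auto simp: pi1_def simp del: topspace_prod_topology) blast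
  qed
  then show ?thesis by auto
qed

text \<open>Allows the condition on \<open>topspace\<close> to be dropped from comprehensions such
  as the one in \<open>pointclass_Collect\<close>.\<close>

lemma pointclass_subset: "A \<in> pointclass \<Gamma> X \<Longrightarrow> A \<subseteq> topspace X"
proof (cases \<Gamma>)
  case (Difference_Sigma \<theta> \<alpha>)
  moreover assume "A \<in> pointclass \<Gamma> X"
  ultimately obtain B where "A = difference_op \<alpha> B" "\<forall>\<beta><\<alpha>. B \<beta> \<in> sigma0 X \<theta>"
    by (auto simp: sigma_diff_def)
  then show ?thesis
    using sigma0_subset[of _ X \<theta>] by (auto simp: difference_op_def)
qed (auto simp: pi0_def pi1_def dest!: dual_class_subset sigma0_subset sigma1_subset)

lemma pointclass_Collect:
  assumes "continuous_map X Y f" "A \<in> pointclass \<Gamma> Y"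
  shows "{x \<in> topspace X. f x \<in> A} \<in> pointclass \<Gamma> X"
proof -
  have "{x \<in> topspace X. f x \<in> A} = topspace X \<inter> f -` A" by auto
  then show ?thesis using pointclass_preimage[OF assms] by simp
qed

text \<open>A continuous change of code is a preimage under a continuous map of the product; in this
  way a universal set is made to read only a part of the code.\<close>

lemma pointclass_reindex:
  assumes f: "continuous_map baire baire f" and B: "B \<in> pointclass \<Gamma> (prod_topology baire X)"
  shows "{(a, x). (f a, x) \<in> B} \<in> pointclass \<Gamma> (prod_topology baire X)"
proof -
  have "continuous_map (prod_topology baire X) (prod_topology baire X) (\<lambda>p. (f (fst p), snd p))"
    using continuous_map_compose[OF continuous_map_fst[of baire X] f]
    by (simp add: continuous_map_pairwise o_def continuous_map_snd)
  from pointclass_Collect[OF this B] show ?thesis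
    using pointclass_subset[OF B] by (auto elim!: back_subst[of "\<lambda>A. A \<in> _"])
qed

lemma pointclass_section:
  assumes V: "V \<in> pointclass \<Gamma> (prod_topology baire X)"
  shows "Pair a -` V \<in> pointclass \<Gamma> X"
proof -
  have "continuous_map X (prod_topology baire X) (Pair a)"
    by (simp add: continuous_map_pairwise o_def)
  from pointclass_Collect[OF this V] show ?thesis
    using pointclass_subset[OF V] by (auto elim!: back_subst[of "\<lambda>A. A \<in> _"])
qed

section \<open>Universal sets\<close>

text \<open>The classical notion of a universal set with codes in the Baire space. Only one
  direction is demanded: that each section of \<open>V\<close> lies in the class follows from
  \<open>pointclass_section\<close>.\<close>

definition has_universal :: "level \<Rightarrow> 'a topology \<Rightarrow> bool" where
  "has_universal \<Gamma> X \<longleftrightarrow>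
    (\<exists>V \<in> pointclass \<Gamma> (prod_topology baire X). \<forall>A \<in> pointclass \<Gamma> X. \<exists>a. A = Pair a -` V)"

lemma has_universalI:
  assumes "V \<in> pointclass \<Gamma> (prod_topology baire X)"
    and "\<And>A. A \<in> pointclass \<Gamma> X \<Longrightarrow> \<exists>a. A = Pair a -` V"
  shows "has_universal \<Gamma> X"
  unfolding has_universal_def by (intro bexI ballI) (fact assms)+

lemma has_universalE:
  assumes "has_universal \<Gamma> X"
  obtains V where "V \<in> pointclass \<Gamma> (prod_topology baire X)"
    and "\<And>A. A \<in> pointclass \<Gamma> X \<Longrightarrow> \<exists>a. A = Pair a -` V"
  using assms unfolding has_universal_def by (elim bexE) (metis (no_types))

lemma continuous_map_into_baire:
  assumes "\<And>n. continuous_map X euclidean (\<lambda>x. f x n)"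
  shows "continuous_map X baire f"
  using assms
  by (subst euclidean_product_topology[symmetric]) (simp only: continuous_map_componentwise_UNIV simp_thms)

lemma continuous_map_baire_coordinate:
  "continuous_map X baire f \<Longrightarrow> continuous_map X euclidean (\<lambda>x. f x n)"
  by (subst (asm) euclidean_product_topology[symmetric]) (simp only: continuous_map_componentwise_UNIV)

lemma continuous_map_reindex: "continuous_map baire baire (\<lambda>a n. a (h n))"
  by (rule continuous_map_into_baire[OF continuous_map_baire_coordinate[OF continuous_map_id[unfolded id_def]]])

text \<open>One code is read as a matrix whose rows code the members of the family, so all of them
  become sections at the same code. The level may vary with \<open>i\<close>, as unions over lower
  Borel levels require.\<close>

lemma has_universal_family:
  assumes I: "countable I" and U: "\<forall>i\<in>I. has_universal (\<Gamma> i) X"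
  shows "\<exists>W. (\<forall>i\<in>I. W i \<in> pointclass (\<Gamma> i) (prod_topology baire X)) \<and>
    (\<forall>A. (\<forall>i\<in>I. A i \<in> pointclass (\<Gamma> i) X) \<longrightarrow> (\<exists>a. \<forall>i\<in>I. A i = Pair a -` W i))"
proof -
  obtain V where V: "\<And>i. i \<in> I \<Longrightarrow> V i \<in> pointclass (\<Gamma> i) (prod_topology baire X)"
    "\<And>i A. i \<in> I \<Longrightarrow> A \<in> pointclass (\<Gamma> i) X \<Longrightarrow> \<exists>a. A = Pair a -` V i"
    using U unfolding has_universal_def by metis
  \<comment> \<open>\<open>p i a\<close> is the row of \<open>a\<close> that belongs to
    \<open>i\<close>.\<close>
  define p :: "_ \<Rightarrow> (nat \<Rightarrow> nat) \<Rightarrow> nat \<Rightarrow> nat"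
    where "p i a n = a (prod_encode (to_nat_on I i, n))" for i a n
  define W where "W i = {(a, x). (p i a, x) \<in> V i}" for i
  show ?thesis
  proof (intro exI[of _ W] conjI ballI allI impI)
    show "W i \<in> pointclass (\<Gamma> i) (prod_topology baire X)" if "i \<in> I" for i
      unfolding W_def p_def by (intro pointclass_reindex V that continuous_map_reindex)
  next
    fix A assume A: "\<forall>i\<in>I. A i \<in> pointclass (\<Gamma> i) X"
    obtain c where c: "\<And>i. i \<in> I \<Longrightarrow> A i = Pair (c i) -` V i"
      using V(2)[OF _ bspec[OF A]] by metis
    \<comment> \<open>Inverse of the splitting: row \<open>to_nat_on I i\<close> receives
      \<open>c i\<close>. Rows outside the range of \<open>to_nat_on I\<close> are read by no
      \<open>p i\<close> with \<open>i \<in> I\<close>.\<close>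
    define a where "a k = c (from_nat_into I (fst (prod_decode k))) (snd (prod_decode k))" for k
    have "p i a = c i" if "i \<in> I" for i
      by (rule ext) (simp add: p_def a_def from_nat_into_to_nat_on[OF I that])
    then have "\<forall>i\<in>I. A i = Pair a -` W i"
      using c by (auto simp: W_def)
    then show "\<exists>a. \<forall>i\<in>I. A i = Pair a -` W i" by (intro exI[of _ a])
  qed
qed

text \<open>Taking sections commutes with complements. Duality is assumed over both spaces because
  the universal set lives in the product and its sections live in \<open>X\<close>.\<close>

lemma has_universal_dual:
  assumes "has_universal \<Gamma> X"
    and X: "pointclass \<Delta> X = dual_class X (pointclass \<Gamma> X)"
    and NX: "pointclass \<Delta> (prod_topology baire X) =
      dual_class (prod_topology baire X) (pointclass \<Gamma> (prod_topology baire X))"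
  shows "has_universal \<Delta> X"
proof -
  obtain V where V: "V \<in> pointclass \<Gamma> (prod_topology baire X)"
    "\<And>A. A \<in> pointclass \<Gamma> X \<Longrightarrow> \<exists>a. A = Pair a -` V"
    using assms(1) by (rule has_universalE) blast
  let ?W = "topspace (prod_topology baire X) - V"
  have "\<exists>a. A = Pair a -` ?W" if A: "A \<in> pointclass \<Delta> X" for A
  proof -
    obtain B where B: "B \<in> pointclass \<Gamma> X" "A = topspace X - B"
      using A X by (auto simp: dual_class_def)
    then obtain a where "B = Pair a -` V" using V(2) by blast
    then have "A = Pair a -` ?W" using B(2) by auto
    then show ?thesis by (intro exI[of _ a])
  qed
  moreover have "?W \<in> pointclass \<Delta> (prod_topology baire X)"
    using V(1) unfolding NX dual_class_def by blast
  ultimately show ?thesis by (intro has_universalI)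
qed

text \<open>Projecting each section of a universal set amounts to projecting the set itself along
  the other Baire coordinate, so only the order of the two Baire coordinates needs care.\<close>

lemma has_universal_projection:
  fixes X :: "'a topology"
  assumes "has_universal \<Gamma> (prod_topology baire X)"
    and X: "pointclass \<Delta> X = {snd ` B |B. B \<in> pointclass \<Gamma> (prod_topology baire X)}"
    and NX: "pointclass \<Delta> (prod_topology baire X) =
      {snd ` B |B. B \<in> pointclass \<Gamma> (prod_topology baire (prod_topology baire X))}"
  shows "has_universal \<Delta> X"
proof -
  let ?N = "prod_topology baire X"
  obtain V where V: "V \<in> pointclass \<Gamma> (prod_topology baire ?N)"
    "\<And>A. A \<in> pointclass \<Gamma> ?N \<Longrightarrow> \<exists>a. A = Pair a -` V"
    using assms(1) by (rule has_universalE) blast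
  \<comment> \<open>Points of \<open>V\<close> are \<open>(a, b, x)\<close> with code
    \<open>a\<close> and projected coordinate \<open>b\<close>. After the swap \<open>snd\<close>
    deletes \<open>b\<close> and keeps the code.\<close>
  let ?g = "\<lambda>p :: (nat \<Rightarrow> nat) \<times> (nat \<Rightarrow> nat) \<times> 'a. (fst (snd p), (fst p, snd (snd p)))"
  have "continuous_map (prod_topology baire ?N) (prod_topology baire ?N) ?g"
    using continuous_map_compose[OF continuous_map_snd[of baire ?N] continuous_map_fst[of baire X]]
      continuous_map_compose[OF continuous_map_snd[of baire ?N] continuous_map_snd[of baire X]]
    by (simp add: continuous_map_pairwise o_def continuous_map_fst)
  from pointclass_Collect[OF this V(1)]
  have "{p \<in> topspace (prod_topology baire ?N). ?g p \<in> V} \<in> pointclass \<Gamma> (prod_topology baire ?N)"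
    (is "?B \<in> _") .
  moreover have B: "(b, a, x) \<in> ?B \<longleftrightarrow> (a, b, x) \<in> V" for a b x
    using pointclass_subset[OF V(1)] by auto
  have "\<exists>a. A = Pair a -` (snd ` ?B)" if A: "A \<in> pointclass \<Delta> X" for A
  proof -
    obtain C where C: "C \<in> pointclass \<Gamma> ?N" "A = snd ` C"
      using A X by auto
    then obtain a where "C = Pair a -` V" using V(2) by blast
    then have "(b, x) \<in> C \<longleftrightarrow> (b, a, x) \<in> ?B" for b x
      unfolding B by simp
    then have "A = Pair a -` (snd ` ?B)"
      unfolding C(2) set_eq_iff vimage_eq image_iff Bex_def split_paired_Ex by simp
    then show ?thesis by (intro exI[of _ a])
  qed
  moreover have "snd ` ?B \<in> pointclass \<Delta> ?N"
    unfolding NX using \<open>?B \<in> pointclass \<Gamma> (prod_topology baire ?N)\<close> by blast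
  ultimately show ?thesis by (intro has_universalI)
qed

text \<open>Pull \<open>A\<close> back to \<open>Y\<close> along \<open>s\<close> and code it there;
  pulling the universal set back along \<open>r\<close> recovers \<open>A\<close> because
  \<open>s\<close> undoes \<open>r\<close>. This moves universal sets between a space and its
  encoding over lists.\<close>

lemma has_universal_retract:
  assumes "has_universal \<Gamma> Y" and r: "continuous_map X Y r" and s: "continuous_map Y X s"
    and sr: "\<And>x. x \<in> topspace X \<Longrightarrow> s (r x) = x"
  shows "has_universal \<Gamma> X"
proof -
  obtain V where V: "V \<in> pointclass \<Gamma> (prod_topology baire Y)"
    "\<And>A. A \<in> pointclass \<Gamma> Y \<Longrightarrow> \<exists>a. A = Pair a -` V"
    using assms(1) by (rule has_universalE) blast
  have "continuous_map (prod_topology baire X) (prod_topology baire Y) (\<lambda>p. (fst p, r (snd p)))"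
    using continuous_map_compose[OF continuous_map_snd[of baire X] r]
    by (simp add: continuous_map_pairwise o_def continuous_map_fst)
  from pointclass_Collect[OF this V(1)]
  have "{p \<in> topspace (prod_topology baire X). (fst p, r (snd p)) \<in> V}
      \<in> pointclass \<Gamma> (prod_topology baire X)" (is "?W \<in> _") .
  moreover have "\<exists>a. A = Pair a -` ?W" if A: "A \<in> pointclass \<Gamma> X" for A
  proof -
    obtain a where a: "{y \<in> topspace Y. s y \<in> A} = Pair a -` V"
      using V(2)[OF pointclass_Collect[OF s A]] by blast
    have "x \<in> A \<longleftrightarrow> (a, r x) \<in> V" if "x \<in> topspace X" for x
      using that sr[OF that] continuous_map_funspace[OF r] eqset_imp_iff[OF a, of "r x"] by auto
    then have "A = Pair a -` ?W"
      using pointclass_subset[OF A] by auto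
    then show ?thesis by (intro exI[of _ a])
  qed
  ultimately show ?thesis by (intro has_universalI)
qed

section \<open>The Borel and difference hierarchies\<close>

lemma omega1_less_three: "\<alpha> < osuc (osuc (osuc ozero)) \<longleftrightarrow>
    \<alpha> = ozero \<or> \<alpha> = osuc ozero \<or> \<alpha> = osuc (osuc ozero)"
  by (metis less_osuc_iff order_le_less ozero_le antisym)

lemma osuc_neq_ozero: "osuc a \<noteq> ozero"
  using less_osuc[of a] ozero_le[of a] by auto

lemma sigma0_one: "sigma0 X (osuc ozero) = {U. openin X U}"
  by (subst sigma0.simps) (simp add: osuc_neq_ozero)

lemma sigma0_two: "sigma0 X (osuc (osuc ozero)) =
    {\<Union>\<A> |\<A>. countable \<A> \<and> \<A> \<subseteq> boolean_combinations X}"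
  by (subst sigma0.simps) (simp add: osuc_neq_ozero osuc_inject)

lemma sigma0_three_le:
  assumes "osuc (osuc (osuc ozero)) \<le> \<alpha>"
  shows "sigma0 X \<alpha> = {\<Union>\<A> |\<A>. countable \<A> \<and> \<A> \<subseteq> (\<Union>\<beta>\<in>{..<\<alpha>}. pi0 X \<beta>)}"
  using assms[folded not_less] unfolding pi0_def omega1_less_three
  by (subst sigma0.simps) simp

text \<open>Needed for its dual \<open>empty_in_pi0\<close>, which provides padding. From level
  three on, the whole space enters as the complement of the empty set of level zero.\<close>

lemma topspace_in_sigma0:
  assumes "\<beta> \<noteq> ozero"
  shows "topspace X \<in> sigma0 X \<beta>"
proof -
  consider "\<beta> = osuc ozero" | "\<beta> = osuc (osuc ozero)" | "osuc (osuc (osuc ozero)) \<le> \<beta>"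
    using assms omega1_less_three[of \<beta>] leI by blast
  then show ?thesis
  proof cases
    case 1
    then show ?thesis by (simp add: sigma0_one)
  next
    case 2
    have "topspace X \<in> boolean_combinations X"
      by (intro boolean_combinations.opn openin_topspace)
    then show ?thesis
      using 2 by (auto simp: sigma0_two intro!: exI[of _ "{topspace X}"])
  next
    case 3
    have "ozero < \<beta>" using assms ozero_le[of \<beta>] by auto
    moreover have "topspace X \<in> pi0 X ozero"
      by (simp add: pi0_def dual_class_def sigma0.simps)
    ultimately have "{topspace X} \<subseteq> (\<Union>\<beta>\<in>{..<\<beta>}. pi0 X \<beta>)" by blast
    then show ?thesis
      unfolding sigma0_three_le[OF 3] by (intro CollectI exI[of _ "{topspace X}"]) simp
  qed
qed

lemma empty_in_pi0: "\<beta> \<noteq> ozero \<Longrightarrow> {} \<in> pi0 X \<beta>"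
  using topspace_in_sigma0[of \<beta> X] by (force simp: pi0_def dual_class_def)

text \<open>The only member of \<open>pi0 X ozero\<close> is the whole space, which is
  closed.\<close>

lemma pi0_ozero_subset: "A \<in> pi0 X ozero \<Longrightarrow> A \<in> pi0 X (osuc ozero)"
  by (auto simp: pi0_def dual_class_def sigma0_one sigma0.simps[of X ozero] image_iff
      intro!: exI[of _ "{}"])

text \<open>
  Level \<open>0\<close> is skipped because \<open>{}\<close>, which serves as padding, is not in \<open>\<Pi>\<^sup>0\<^sub>0\<close> of a nonempty space.
\<close>

lemma sigma0_three_le_iff:
  assumes \<alpha>: "osuc (osuc (osuc ozero)) \<le> \<alpha>"
  shows "A \<in> sigma0 X \<alpha> \<longleftrightarrow>
    (\<exists>B. (\<forall>i \<in> {ozero<..<\<alpha>} \<times> (UNIV :: nat set). B i \<in> pi0 X (fst i)) \<and>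
      A = (\<Union>i \<in> {ozero<..<\<alpha>} \<times> UNIV. B i))"
    (is "_ \<longleftrightarrow> (\<exists>B. (\<forall>i \<in> ?I. _) \<and> _)")
proof
  assume "A \<in> sigma0 X \<alpha>"
  then obtain \<A> where \<A>: "countable \<A>" "\<A> \<subseteq> (\<Union>\<beta>\<in>{..<\<alpha>}. pi0 X \<beta>)" "A = \<Union>\<A>"
    unfolding sigma0_three_le[OF \<alpha>] by blast
  \<comment> \<open>Inserting \<open>{}\<close> makes the enumerated set nonempty without changing
    its union.\<close>
  define f where "f = from_nat_into (insert {} \<A>)"
  have f: "range f = insert {} \<A>"
    unfolding f_def using \<A>(1) by (intro range_from_nat_into) auto
  define B where "B i = (if f (snd i) \<in> pi0 X (fst i) then f (snd i) else {})" for i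
  have 1: "osuc ozero \<in> {ozero<..<\<alpha>}"
    using less_le_trans[OF omega1_less_three[THEN iffD2] \<alpha>, of "osuc ozero"]
    by (simp add: less_osuc)
  have "C \<subseteq> (\<Union>i \<in> ?I. B i)" if C: "C \<in> \<A>" for C
  proof -
    obtain \<beta> where \<beta>: "\<beta> < \<alpha>" "C \<in> pi0 X \<beta>" using \<A>(2) C by blast
    \<comment> \<open>A set of level zero is filed under level one, which lies below
      \<open>\<alpha>\<close>.\<close>
    have "\<exists>\<beta> \<in> {ozero<..<\<alpha>}. C \<in> pi0 X \<beta>"
    proof (cases "\<beta> = ozero")
      case True
      then show ?thesis using 1 \<beta>(2) pi0_ozero_subset by blast
    next
      case False
      then have "ozero < \<beta>" using ozero_le[of \<beta>] by auto
      then show ?thesis using \<beta> by auto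
    qed
    then obtain \<gamma> where \<gamma>: "\<gamma> \<in> {ozero<..<\<alpha>}" "C \<in> pi0 X \<gamma>" by blast
    have "C \<in> range f" using f C by simp
    then obtain k where "C = f k" by blast
    then have "B (\<gamma>, k) = C" using \<gamma> by (simp add: B_def)
    moreover have "(\<gamma>, k) \<in> ?I" using \<gamma>(1) by simp
    ultimately show ?thesis by blast
  qed
  then have "A \<subseteq> (\<Union>i \<in> ?I. B i)" unfolding \<A>(3) by (rule Union_least)
  moreover have "f k \<subseteq> A" for k
    using rangeI[of f k] unfolding f \<A>(3) by auto
  then have "(\<Union>i \<in> ?I. B i) \<subseteq> A"
    by (intro UN_least) (simp add: B_def)
  ultimately have "A = (\<Union>i \<in> ?I. B i)" by (rule equalityI)
  moreover have "\<forall>i \<in> ?I. B i \<in> pi0 X (fst i)"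
    by (auto simp: B_def empty_in_pi0)
  ultimately show "\<exists>B. (\<forall>i \<in> ?I. B i \<in> pi0 X (fst i)) \<and> A = (\<Union>i \<in> ?I. B i)" by blast
next
  assume "\<exists>B. (\<forall>i \<in> ?I. B i \<in> pi0 X (fst i)) \<and> A = (\<Union>i \<in> ?I. B i)"
  then obtain B where B: "\<forall>i \<in> ?I. B i \<in> pi0 X (fst i)" "A = \<Union>(B ` ?I)" by blast
  have "countable {ozero<..<\<alpha>}"
    by (rule countable_subset[OF _ countable_lessThan_omega1[of \<alpha>]]) auto
  then have "countable (B ` ?I)" by simp
  moreover have "B i \<in> (\<Union>\<beta>\<in>{..<\<alpha>}. pi0 X \<beta>)" if "i \<in> ?I" for i
    using bspec[OF B(1) that] that by (intro UN_I[of "fst i"]) auto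
  then have "B ` ?I \<subseteq> (\<Union>\<beta>\<in>{..<\<alpha>}. pi0 X \<beta>)" by (rule image_subsetI)
  ultimately show "A \<in> sigma0 X \<alpha>"
    unfolding sigma0_three_le[OF \<alpha>] using B(2) by blast
qed

section \<open>The second Borel level as countable unions of differences of open sets\<close>

text \<open>A normal form for level two, justified in \<open>sigma0_two_eq\<close>. Finite Boolean
  combinations have no fixed shape to code, while here two sequences of open sets suffice.\<close>

definition sigma_of_differences :: "'a topology \<Rightarrow> 'a set set" where
  "sigma_of_differences X = {\<Union>i::nat. U i - V i |U V. \<forall>i. openin X (U i) \<and> openin X (V i)}"

lemma sigma_of_differencesI:
  "(\<And>i. openin X (U i)) \<Longrightarrow> (\<And>i. openin X (V i)) \<Longrightarrow>
    (\<Union>i::nat. U i - V i) \<in> sigma_of_differences X"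
  unfolding sigma_of_differences_def by blast

lemma sigma_of_differencesD:
  "A \<in> sigma_of_differences X \<Longrightarrow>
    \<exists>U V. A = (\<Union>i::nat. U i - V i) \<and> (\<forall>i. openin X (U i)) \<and> (\<forall>i. openin X (V i))"
  unfolding sigma_of_differences_def mem_Collect_eq all_conj_distrib .

lemma openin_diff_sigma_of_differences:
  "openin X U \<Longrightarrow> openin X V \<Longrightarrow> U - V \<in> sigma_of_differences X"
  using sigma_of_differencesI[of X "\<lambda>_. U" "\<lambda>_. V"] by simp

lemma sigma_of_differences_UN:
  assumes "\<And>n::nat. A n \<in> sigma_of_differences X"
  shows "(\<Union>n. A n) \<in> sigma_of_differences X"
proof -
  have "\<forall>n. \<exists>U V. (\<forall>i. openin X (U i) \<and> openin X (V i)) \<and> A n = (\<Union>i::nat. U i - V i)"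
    using assms unfolding sigma_of_differences_def by blast
  then obtain U V where UV: "\<And>n i. openin X (U n i)" "\<And>n i. openin X (V n i)"
    "\<And>n. A n = (\<Union>i::nat. U n i - V n i)"
    by metis
  let ?U = "\<lambda>k. U (fst (prod_decode k)) (snd (prod_decode k))"
  let ?V = "\<lambda>k. V (fst (prod_decode k)) (snd (prod_decode k))"
  have "(\<Union>n. A n) = (\<Union>k. ?U k - ?V k)"
  proof (intro equalityI subsetI)
    fix x assume "x \<in> (\<Union>n. A n)"
    then obtain n i where "x \<in> U n i - V n i" unfolding UV(3) by blast
    then show "x \<in> (\<Union>k. ?U k - ?V k)"
      by (intro UN_I[of "prod_encode (n, i)"]) simp_all
  next
    fix x assume "x \<in> (\<Union>k. ?U k - ?V k)"
    then show "x \<in> (\<Union>n. A n)" unfolding UV(3) by blast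
  qed
  also have "\<dots> \<in> sigma_of_differences X"
    using UV(1,2) by (intro sigma_of_differencesI)
  finally show ?thesis .
qed

lemma sigma_of_differences_Un:
  assumes "A \<in> sigma_of_differences X" "B \<in> sigma_of_differences X"
  shows "A \<union> B \<in> sigma_of_differences X"
proof -
  let ?C = "\<lambda>n. if n = (0::nat) then A else B"
  have "?C 0 \<subseteq> (\<Union>n. ?C n)" "?C 1 \<subseteq> (\<Union>n. ?C n)"
    by (rule UN_upper, simp)+
  then have "A \<union> B = (\<Union>n. ?C n)"
    by (intro equalityI UN_least) simp_all
  also have "\<dots> \<in> sigma_of_differences X"
    using assms by (intro sigma_of_differences_UN) auto
  finally show ?thesis .
qed

text \<open>Intersection distributes over both unions, and two differences of open sets meet in
  another such difference.\<close>

lemma sigma_of_differences_Int: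
  assumes "A \<in> sigma_of_differences X" "B \<in> sigma_of_differences X"
  shows "A \<inter> B \<in> sigma_of_differences X"
proof -
  obtain U V where UV:
      "A = (\<Union>i::nat. U i - V i)" "\<forall>i. openin X (U i)" "\<forall>i. openin X (V i)"
    using sigma_of_differencesD[OF assms(1)] by (elim exE conjE)
  obtain U' V' where UV':
      "B = (\<Union>i::nat. U' i - V' i)" "\<forall>i. openin X (U' i)" "\<forall>i. openin X (V' i)"
    using sigma_of_differencesD[OF assms(2)] by (elim exE conjE)
  have "A \<inter> B = (\<Union>i. \<Union>j. (U i - V i) \<inter> (U' j - V' j))"
    unfolding UV(1) UV'(1) by (simp only: Int_UN_distrib2)
  also have "\<dots> = (\<Union>i. \<Union>j. (U i \<inter> U' j) - (V i \<union> V' j))"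
    by (intro SUP_cong refl) blast
  also have "\<dots> \<in> sigma_of_differences X"
    using UV(2,3) UV'(2,3)
    by (intro sigma_of_differences_UN openin_diff_sigma_of_differences openin_Int openin_Un) simp_all
  finally show ?thesis .
qed

text \<open>The class need not be closed under complements, so the complement is carried through the
  induction: the complement step exchanges the two claims, and the union step needs closure under
  intersection.\<close>

lemma boolean_combinations_sigma_of_differences:
  assumes "A \<in> boolean_combinations X"
  shows "A \<in> sigma_of_differences X \<and> topspace X - A \<in> sigma_of_differences X"
  using assms
proof induction
  case (opn U)
  then show ?case
    using openin_diff_sigma_of_differences[of X U "{}"]
      openin_diff_sigma_of_differences[of X "topspace X" U] by auto
next
  case (compl A)
  then have "topspace X - (topspace X - A) = A"
    using boolean_combinations_subset by blast
  then show ?case using compl by simp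
next
  case (union A B)
  have "topspace X - (A \<union> B) = (topspace X - A) \<inter> (topspace X - B)" by blast
  then show ?case
    using union sigma_of_differences_Un sigma_of_differences_Int by metis
qed

lemma sigma0_two_eq: "sigma0 X (osuc (osuc ozero)) = sigma_of_differences X"
proof (intro equalityI subsetI)
  fix A assume "A \<in> sigma0 X (osuc (osuc ozero))"
  then obtain \<A> where \<A>: "countable \<A>" "\<A> \<subseteq> boolean_combinations X" "A = \<Union>\<A>"
    unfolding sigma0_two by blast
  let ?\<A> = "insert {} \<A>"
  have r: "range (from_nat_into ?\<A>) = ?\<A>"
    using \<A>(1) by (intro range_from_nat_into) auto
  have "?\<A> \<subseteq> boolean_combinations X"
    using \<A>(2) boolean_combinations.opn[OF openin_empty] by simp
  then have "from_nat_into ?\<A> n \<in> boolean_combinations X" for n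
    by (rule subsetD) (rule from_nat_into, simp)
  then have "from_nat_into ?\<A> n \<in> sigma_of_differences X" for n
    by (rule boolean_combinations_sigma_of_differences[THEN conjunct1])
  then have "(\<Union>n. from_nat_into ?\<A> n) \<in> sigma_of_differences X"
    by (rule sigma_of_differences_UN)
  then show "A \<in> sigma_of_differences X" unfolding r \<A>(3) by simp
next
  fix A assume A: "A \<in> sigma_of_differences X"
  obtain U V where UV:
      "A = (\<Union>i::nat. U i - V i)" "\<forall>i. openin X (U i)" "\<forall>i. openin X (V i)"
    using sigma_of_differencesD[OF A] by (elim exE conjE)
  have "U i - V i \<in> boolean_combinations X" for i
  proof -
    have "openin X (U i)" "openin X (V i)" using UV(2,3) by simp_all
    note this[THEN boolean_combinations.opn]
    \<comment> \<open>\<open>U i - V i\<close> is the complement of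
      \<open>(topspace X - U i) \<union> V i\<close>.\<close>
    from boolean_combinations.compl[OF boolean_combinations.union[OF boolean_combinations.compl[OF this(1)] this(2)]]
    show ?thesis
      using openin_subset[OF \<open>openin X (U i)\<close>]
      by (auto simp: Diff_Un double_diff Diff_Int_distrib elim!: back_subst[of "\<lambda>A. A \<in> _"])
  qed
  then show "A \<in> sigma0 X (osuc (osuc ozero))"
    unfolding sigma0_two UV(1) by (intro CollectI exI[of _ "range (\<lambda>i. U i - V i)"]) auto
qed

section \<open>Universal sets for the Borel levels\<close>

lemma openin_code_neq_0: "openin baire {a. a n \<noteq> (0::nat)}"
  using openin_continuous_map_preimage[OF
      continuous_map_baire_coordinate[OF continuous_map_id[unfolded id_def], of n], of "- {0}"]
  by (auto simp: open_discrete elim!: back_subst[of "openin _"])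

text \<open>A code \<open>a\<close> stands for the union of the basic sets \<open>f n\<close> with
  \<open>a n \<noteq> 0\<close>. Each such condition concerns one coordinate of \<open>a\<close>, so
  the universal set is a union of open rectangles.\<close>

lemma has_universal_open:
  assumes "second_countable X"
  shows "has_universal (Borel_Sigma (osuc ozero)) X"
proof -
  obtain \<B> where \<B>: "countable \<B>" "\<forall>V \<in> \<B>. openin X V"
    "\<forall>U x. openin X U \<and> x \<in> U \<longrightarrow> (\<exists>V \<in> \<B>. x \<in> V \<and> V \<subseteq> U)"
    using assms unfolding second_countable_def by blast
  define f where "f = from_nat_into (insert {} \<B>)"
  have f: "range f = insert {} \<B>"
    unfolding f_def using \<B>(1) by (intro range_from_nat_into) auto
  let ?V = "\<Union>n. {a. a n \<noteq> (0::nat)} \<times> f n"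
  have "openin X (f n)" for n
    using f \<B>(2) by (metis insert_iff openin_empty rangeI)
  then have "openin (prod_topology baire X) ({a. a n \<noteq> (0::nat)} \<times> f n)" for n
    unfolding openin_prod_Times_iff using openin_code_neq_0 by blast
  then have "openin (prod_topology baire X) ?V"
    by (intro openin_Union) (elim imageE, simp only:)
  moreover have "\<exists>a. U = Pair a -` ?V" if U: "openin X U" for U
  proof -
    have "\<exists>n. x \<in> f n \<and> f n \<subseteq> U" if "x \<in> U" for x
      using f \<B>(3) U that by (metis insertCI rangeE)
    then have U_iff: "x \<in> U \<longleftrightarrow> (\<exists>n. f n \<subseteq> U \<and> x \<in> f n)" for x by blast
    have "(if f n \<subseteq> U then 1 else 0 :: nat) \<noteq> 0 \<longleftrightarrow> f n \<subseteq> U" for n by simp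
    \<comment> \<open>This code selects every basic set contained in \<open>U\<close>.\<close>
    then have "U = Pair (\<lambda>n. if f n \<subseteq> U then 1 else 0) -` ?V"
      using U_iff unfolding set_eq_iff vimage_eq UN_iff mem_Times_iff fst_conv snd_conv
        mem_Collect_eq by simp
    then show ?thesis by (intro exI[of _ "\<lambda>n. if f n \<subseteq> U then 1 else 0"])
  qed
  ultimately show ?thesis by (intro has_universalI) (simp_all add: sigma0_one)
qed

lemma has_universal_Borel_Pi:
  "has_universal (Borel_Sigma \<alpha>) X \<Longrightarrow> has_universal (Borel_Pi \<alpha>) X"
  by (erule has_universal_dual) (simp_all add: pi0_def)

lemma has_universal_sigma_two:
  assumes "second_countable X"
  shows "has_universal (Borel_Sigma (osuc (osuc ozero))) X"
proof -
  \<comment> \<open>The Boolean index separates the two sequences of the normal form: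
    \<open>True\<close> marks the minuends, \<open>False\<close> the subtrahends.\<close>
  from has_universal_family[where I = UNIV and \<Gamma> = "\<lambda>_. Borel_Sigma (osuc ozero)",
      OF countableI_type ballI[OF has_universal_open[OF assms]]]
  obtain W :: "bool \<times> nat \<Rightarrow> ((nat \<Rightarrow> nat) \<times> 'a) set" where
    W: "\<forall>i. openin (prod_topology baire X) (W i)"
      "\<forall>A. (\<forall>i. openin X (A i)) \<longrightarrow> (\<exists>a. \<forall>i. A i = Pair a -` W i)"
    unfolding pointclass.simps sigma0_one mem_Collect_eq ball_UNIV by (elim exE conjE)
  let ?V = "\<Union>n. W (True, n) - W (False, n)"
  have "?V \<in> sigma0 (prod_topology baire X) (osuc (osuc ozero))"
    unfolding sigma0_two_eq using W(1) by (intro sigma_of_differencesI) simp_all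
  moreover have "\<exists>a. A = Pair a -` ?V" if A: "A \<in> sigma0 X (osuc (osuc ozero))" for A
  proof -
    obtain P Q where PQ:
      "A = (\<Union>i::nat. P i - Q i)" "\<forall>i. openin X (P i)" "\<forall>i. openin X (Q i)"
      using sigma_of_differencesD[OF A[unfolded sigma0_two_eq]] by (elim exE conjE)
    have "\<forall>i. openin X ((\<lambda>i. if fst i then P (snd i) else Q (snd i)) i)"
      using PQ(2,3) by simp
    from W(2)[rule_format, OF this[rule_format]]
    obtain a where a: "\<forall>i. (if fst i then P (snd i) else Q (snd i)) = Pair a -` W i" ..
    have "P n = Pair a -` W (True, n)" "Q n = Pair a -` W (False, n)" for n
      using a[rule_format, of "(True, n)"] a[rule_format, of "(False, n)"] by simp_all
    then have "A = Pair a -` ?V"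
      unfolding PQ(1) by (simp add: vimage_UN vimage_Diff)
    then show ?thesis by (intro exI[of _ a])
  qed
  ultimately show ?thesis by (intro has_universalI) (simp_all only: pointclass.simps)
qed

text \<open>From level three on, \<open>sigma0_three_le_iff\<close> presents all members of the
  class as unions over one countable index set with prescribed levels, so
  \<open>has_universal_family\<close> applies to the lower dual levels.\<close>

lemma has_universal_Borel_Sigma:
  assumes X: "second_countable X"
  shows "has_universal (Borel_Sigma \<alpha>) X"
proof (induction \<alpha> rule: less_induct)
  case (less \<alpha>)
  consider "\<alpha> = ozero" | "\<alpha> = osuc ozero" | "\<alpha> = osuc (osuc ozero)"
    | (big) "osuc (osuc (osuc ozero)) \<le> \<alpha>"
    using omega1_less_three[of \<alpha>] leI by blast
  then show ?case
  proof cases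
    case 1
    then show ?thesis by (simp add: has_universal_def sigma0.simps)
  next
    case 2
    then show ?thesis using has_universal_open[OF X] by simp
  next
    case 3
    then show ?thesis using has_universal_sigma_two[OF X] by simp
  next
    case big
    let ?I = "{ozero<..<\<alpha>} \<times> (UNIV :: nat set)"
    have "countable {ozero<..<\<alpha>}"
      by (rule countable_subset[OF _ countable_lessThan_omega1[of \<alpha>]]) auto
    then have I: "countable ?I" by simp
    have "\<forall>i\<in>?I. has_universal (Borel_Pi (fst i)) X"
      by (intro ballI has_universal_Borel_Pi less.IH) auto
    from has_universal_family[where \<Gamma> = "\<lambda>i. Borel_Pi (fst i)", OF I this] obtain W where
      W: "\<forall>i\<in>?I. W i \<in> pi0 (prod_topology baire X) (fst i)"
        "\<forall>A. (\<forall>i\<in>?I. A i \<in> pi0 X (fst i)) \<longrightarrow> (\<exists>a. \<forall>i\<in>?I. A i = Pair a -` W i)"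
      unfolding pointclass.simps by (elim exE conjE)
    let ?V = "\<Union>i\<in>?I. W i"
    have "?V \<in> sigma0 (prod_topology baire X) \<alpha>"
      unfolding sigma0_three_le_iff[OF big] using W(1) by (intro exI[of _ W] conjI refl)
    moreover have "\<exists>a. A = Pair a -` ?V" if A: "A \<in> sigma0 X \<alpha>" for A
    proof -
      obtain B where B: "\<forall>i \<in> ?I. B i \<in> pi0 X (fst i)" "A = (\<Union>i\<in>?I. B i)"
        using A unfolding sigma0_three_le_iff[OF big] by blast
      from W(2)[rule_format, OF B(1)[rule_format]]
      obtain a where a: "\<forall>i\<in>?I. B i = Pair a -` W i" ..
      have "A = Pair a -` ?V"
        unfolding B(2) vimage_UN by (intro SUP_cong refl) (rule bspec[OF a])
      then show ?thesis by (intro exI[of _ a])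
    qed
    ultimately show ?thesis by (intro has_universalI) (simp_all only: pointclass.simps)
  qed
qed

section \<open>Universal sets for the difference levels\<close>

text \<open>Preimages commute with unions and differences, and \<open>difference_op \<alpha>\<close>
  consults only indices below \<open>\<alpha>\<close>. With \<open>f = Pair a\<close> this computes
  sections.\<close>

lemma difference_op_vimage:
  assumes "\<And>\<beta>. \<beta> < \<alpha> \<Longrightarrow> B \<beta> = f -` A \<beta>"
  shows "difference_op \<alpha> B = f -` difference_op \<alpha> A"
proof -
  have "B \<beta> - (\<Union>\<gamma>\<in>{..<\<beta>}. B \<gamma>) = f -` (A \<beta> - (\<Union>\<gamma>\<in>{..<\<beta>}. A \<gamma>))" if "\<beta> < \<alpha>" for \<beta>
  proof -
    have "(\<Union>\<gamma>\<in>{..<\<beta>}. B \<gamma>) = (\<Union>\<gamma>\<in>{..<\<beta>}. f -` A \<gamma>)"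
      using that by (intro SUP_cong refl assms) (simp add: less_trans[of _ \<beta> \<alpha>])
    then show ?thesis
      using assms[OF that] by (simp only: vimage_Diff vimage_UN)
  qed
  then show ?thesis
    unfolding difference_op_def vimage_UN by (intro SUP_cong refl) simp
qed

text \<open>Since \<open>\<alpha>\<close> is countable, a single code serves all constituents of a
  difference.\<close>

lemma has_universal_Difference_Sigma:
  assumes "has_universal (Borel_Sigma \<theta>) X"
  shows "has_universal (Difference_Sigma \<theta> \<alpha>) X"
proof -
  from has_universal_family[OF countable_lessThan_omega1[of \<alpha>], of "\<lambda>_. Borel_Sigma \<theta>",
      OF ballI[OF assms]]
  obtain W where
    W: "\<forall>\<beta>\<in>{..<\<alpha>}. W \<beta> \<in> sigma0 (prod_topology baire X) \<theta>"
      "\<forall>A. (\<forall>\<beta>\<in>{..<\<alpha>}. A \<beta> \<in> sigma0 X \<theta>) \<longrightarrow> (\<exists>a. \<forall>\<beta>\<in>{..<\<alpha>}. A \<beta> = Pair a -` W \<beta>)"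
    unfolding pointclass.simps by (elim exE conjE)
  have "difference_op \<alpha> W \<in> sigma_diff (prod_topology baire X) \<theta> \<alpha>"
    using W(1) by (auto simp: sigma_diff_def)
  moreover have "\<exists>a. A = Pair a -` difference_op \<alpha> W" if A: "A \<in> sigma_diff X \<theta> \<alpha>" for A
  proof -
    obtain B where B: "A = difference_op \<alpha> B" "\<forall>\<beta><\<alpha>. B \<beta> \<in> sigma0 X \<theta>"
      using A by (auto simp: sigma_diff_def)
    then have "\<forall>\<beta>\<in>{..<\<alpha>}. B \<beta> \<in> sigma0 X \<theta>" by simp
    from W(2)[rule_format, OF this[rule_format]]
    obtain a where "\<forall>\<beta>\<in>{..<\<alpha>}. B \<beta> = Pair a -` W \<beta>" ..
    then show ?thesis
      unfolding B(1) by (intro exI[of _ a] difference_op_vimage) simp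
  qed
  ultimately show ?thesis by (intro has_universalI) (simp_all only: pointclass.simps)
qed

section \<open>The projective hierarchy\<close>

lemma second_countable_euclidean:
  "second_countable (euclidean :: 'a::second_countable_topology topology)"
proof -
  obtain B :: "'a set set" where "countable B" "topological_basis B"
    using ex_countable_basis by blast
  then show ?thesis
    unfolding second_countable_def open_openin[symmetric]
    by (intro exI[of _ B]) (metis topological_basisE topological_basis_open)
qed

lemma second_countableI:
  assumes "countable \<B>" "\<And>V. V \<in> \<B> \<Longrightarrow> openin X V"
    and "\<And>U x. openin X U \<Longrightarrow> x \<in> U \<Longrightarrow> \<exists>V \<in> \<B>. x \<in> V \<and> V \<subseteq> U"
  shows "second_countable X"
  unfolding second_countable_def
  by (intro exI[of _ \<B>] conjI ballI allI impI; (elim conjE)?; rule assms; assumption?)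

lemma second_countable_prod_topology:
  assumes "second_countable X" "second_countable Y"
  shows "second_countable (prod_topology X Y)"
proof -
  obtain \<B> where \<B>: "countable \<B>" "\<forall>V \<in> \<B>. openin X V"
    "\<forall>U x. openin X U \<and> x \<in> U \<longrightarrow> (\<exists>V \<in> \<B>. x \<in> V \<and> V \<subseteq> U)"
    using assms(1) unfolding second_countable_def by blast
  obtain \<C> where \<C>: "countable \<C>" "\<forall>V \<in> \<C>. openin Y V"
    "\<forall>U x. openin Y U \<and> x \<in> U \<longrightarrow> (\<exists>V \<in> \<C>. x \<in> V \<and> V \<subseteq> U)"
    using assms(2) unfolding second_countable_def by blast
  let ?D = "(\<lambda>(U, V). U \<times> V) ` (\<B> \<times> \<C>)"
  show ?thesis
  proof (rule second_countableI)
    show "countable ?D" using \<B>(1) \<C>(1) by simp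
    show "openin (prod_topology X Y) D" if D: "D \<in> ?D" for D
    proof -
      obtain U V where "U \<in> \<B>" "V \<in> \<C>" "D = U \<times> V" using D by auto
      then show ?thesis using \<B>(2) \<C>(2) by (simp add: openin_prod_Times_iff)
    qed
    fix S p assume S: "openin (prod_topology X Y) S" "p \<in> S"
    from S(2) have "(fst p, snd p) \<in> S" by simp
    from S(1)[unfolded openin_prod_topology_alt, rule_format, OF this]
    obtain U V where UV: "openin X U" "openin Y V" "fst p \<in> U" "snd p \<in> V" "U \<times> V \<subseteq> S"
      by (elim exE conjE)
    obtain U' where U': "U' \<in> \<B>" "fst p \<in> U'" "U' \<subseteq> U"
      using \<B>(3)[rule_format, OF conjI, OF UV(1,3)] by blast
    obtain V' where V': "V' \<in> \<C>" "snd p \<in> V'" "V' \<subseteq> V"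
      using \<C>(3)[rule_format, OF conjI, OF UV(2,4)] by blast
    have "U' \<times> V' \<in> ?D"
      using U'(1) V'(1) by (intro image_eqI[of _ _ "(U', V')"]) auto
    moreover have "p \<in> U' \<times> V'" using U'(2) V'(2) by (simp add: mem_Times_iff)
    moreover have "U' \<times> V' \<subseteq> S"
      using Sigma_mono[OF U'(3) V'(3)] UV(5) by (rule subset_trans)
    ultimately show "\<exists>D \<in> ?D. p \<in> D \<and> D \<subseteq> S" by (intro bexI conjI)
  qed
qed

text \<open>Preimages of basic sets form a base. This covers \<open>baire_times\<close> and
  \<open>base_space\<close>, which are pullbacks.\<close>

lemma second_countable_pullback_topology:
  assumes "second_countable X"
  shows "second_countable (pullback_topology A f X)"
proof -
  obtain \<B> where \<B>: "countable \<B>" "\<forall>V \<in> \<B>. openin X V"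
    "\<forall>U x. openin X U \<and> x \<in> U \<longrightarrow> (\<exists>V \<in> \<B>. x \<in> V \<and> V \<subseteq> U)"
    using assms unfolding second_countable_def by blast
  show ?thesis
  proof (rule second_countableI)
    show "countable ((\<lambda>V. f -` V \<inter> A) ` \<B>)" using \<B>(1) by simp
    show "openin (pullback_topology A f X) D" if "D \<in> (\<lambda>V. f -` V \<inter> A) ` \<B>" for D
      using that \<B>(2) unfolding openin_pullback_topology by blast
    fix S x assume S: "openin (pullback_topology A f X) S" "x \<in> S"
    obtain U where U: "openin X U" "S = f -` U \<inter> A"
      using S(1) unfolding openin_pullback_topology by blast
    then have "f x \<in> U" using S(2) by simp
    then obtain V where "V \<in> \<B>" "f x \<in> V" "V \<subseteq> U"
      using \<B>(3)[rule_format, OF conjI, OF U(1)] by blast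
    then show "\<exists>D \<in> (\<lambda>V. f -` V \<inter> A) ` \<B>. x \<in> D \<and> D \<subseteq> S"
      using U(2) S(2) by (intro bexI[of _ "f -` V \<inter> A"]) auto
  qed
qed

lemma second_countable_prod_baire:
  "second_countable X \<Longrightarrow> second_countable (prod_topology baire X)"
  by (intro second_countable_prod_topology second_countable_euclidean)

lemma second_countable_baire_times: "second_countable T \<Longrightarrow> second_countable (baire_times T)"
  unfolding baire_times_def
  by (intro second_countable_pullback_topology second_countable_prod_baire)

lemma second_countable_base_space: "second_countable X \<Longrightarrow> second_countable (base_space X)"
  unfolding base_space_def by (rule second_countable_pullback_topology)

section \<open>Universal sets for the projective levels\<close>

lemma has_universal_Luzin_Pi: "has_universal (Luzin_Sigma n) X \<Longrightarrow> has_universal (Luzin_Pi n) X"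
  by (erule has_universal_dual) (simp_all add: pi1_def)

text \<open>
  The induction on the level enlarges the space by a Baire factor; \<open>baire_times\<close> absorbs this factor
  without leaving the type, so the induction is carried out on spaces over lists first.
\<close>

lemma has_universal_Luzin_Sigma_list:
  fixes T :: "((nat \<Rightarrow> nat) list \<times> 'a) topology"
  assumes "second_countable T"
  shows "has_universal (Luzin_Sigma (Suc n)) T"
  using assms
proof (induction n arbitrary: T)
  case (0 T)
  show ?case
  proof (rule has_universal_projection)
    show "has_universal (Borel_Pi (osuc (osuc ozero))) (prod_topology baire T)"
      by (intro has_universal_Borel_Pi has_universal_Borel_Sigma second_countable_prod_baire 0)
  qed (use sigma1_one in auto)
next
  case (Suc n T)
  show ?case
  proof (rule has_universal_projection)
    \<comment> \<open>The induction hypothesis speaks only of spaces over the list type. It is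
      applied to \<open>baire_times T\<close>, of which \<open>prod_topology baire T\<close> is a
      retract by consing and \<open>uncons\<close>.\<close>
    have "continuous_map (prod_topology baire T) (baire_times T)
        (\<lambda>p. (fst p # fst (snd p), snd (snd p)))"
      by (intro continuous_map_into_baire_times continuous_map_fst continuous_map_snd)
    then have "has_universal (Luzin_Sigma (Suc n)) (prod_topology baire T)"
      by (rule has_universal_retract[OF Suc.IH[OF second_countable_baire_times[OF Suc.prems]]
            _ continuous_map_uncons])
        (simp add: uncons_def)
    then show "has_universal (Luzin_Pi (Suc n)) (prod_topology baire T)"
      by (rule has_universal_Luzin_Pi)
  qed (simp_all add: sigma1_Suc)
qed

text \<open>\<open>X\<close> is a retract of \<open>base_space X\<close>: pair with the empty list,
  then apply \<open>snd\<close>.\<close>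

lemma has_universal_Luzin_Sigma:
  assumes "second_countable X"
  shows "has_universal (Luzin_Sigma (Suc n)) X"
  using has_universal_Luzin_Sigma_list[OF second_countable_base_space[OF assms]]
    continuous_map_into_base[OF continuous_map_id] continuous_map_snd_base
  by (rule has_universal_retract) simp

section \<open>Principal total representations\<close>

lemma has_universal_level:
  assumes "second_countable X" "is_level \<Gamma>"
  shows "has_universal \<Gamma> X"
proof (cases \<Gamma>)
  case (Borel_Sigma \<alpha>)
  then show ?thesis using has_universal_Borel_Sigma[OF assms(1)] by simp
next
  case (Borel_Pi \<alpha>)
  then show ?thesis using has_universal_Borel_Pi[OF has_universal_Borel_Sigma[OF assms(1)]] by simp
next
  case (Difference_Sigma \<theta> \<alpha>)
  then show ?thesis
    using has_universal_Difference_Sigma[OF has_universal_Borel_Sigma[OF assms(1)]] by simp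
next
  case (Difference_Pi \<theta> \<alpha>)
  have "has_universal (Difference_Sigma \<theta> \<alpha>) X"
    by (rule has_universal_Difference_Sigma[OF has_universal_Borel_Sigma[OF assms(1)]])
  then have "has_universal (Difference_Pi \<theta> \<alpha>) X"
    by (rule has_universal_dual) simp_all
  then show ?thesis using Difference_Pi by simp
next
  case (Luzin_Sigma n)
  \<comment> \<open>Projective levels start at 1, so \<open>Suc (n - 1) = n\<close>.\<close>
  then show ?thesis using has_universal_Luzin_Sigma[OF assms(1), of "n - 1"] assms(2) by simp
next
  case (Luzin_Pi n)
  then show ?thesis
    using has_universal_Luzin_Pi[OF has_universal_Luzin_Sigma[OF assms(1), of "n - 1"]] assms(2)
    by simp
qed

text \<open>Coding the universal set of \<open>\<mu>\<close> as a whole, not each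
  \<open>\<mu> c\<close> separately, keeps \<open>b\<close> constant and so makes the reduction
  continuous.\<close>

lemma principal_total_representation_exists:
  fixes X :: "'a topology"
  assumes "has_universal \<Gamma> (prod_topology baire X)"
  shows "\<exists>\<nu>. principal_total_representation \<Gamma> X \<nu>"
proof -
  let ?N = "prod_topology baire X"
  obtain V where V: "V \<in> pointclass \<Gamma> (prod_topology baire ?N)"
    "\<And>A. A \<in> pointclass \<Gamma> ?N \<Longrightarrow> \<exists>a. A = Pair a -` V"
    using assms by (rule has_universalE) blast
  \<comment> \<open>The even entries of a code form \<open>b\<close>, the odd ones
    \<open>c\<close>.\<close>
  define g :: "(nat \<Rightarrow> nat) \<times> 'a \<Rightarrow> (nat \<Rightarrow> nat) \<times> (nat \<Rightarrow> nat) \<times> 'a"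
    where "g p = ((\<lambda>n. fst p (2 * n)), (\<lambda>n. fst p (2 * n + 1)), snd p)" for p
  have "continuous_map ?N baire (\<lambda>p n. fst p (h n))" for h
    using continuous_map_compose[OF continuous_map_fst[of baire X] continuous_map_reindex]
    by (simp add: o_def)
  then have "continuous_map ?N (prod_topology baire ?N) g"
    by (simp add: continuous_map_pairwise o_def g_def[abs_def] continuous_map_snd)
  from pointclass_Collect[OF this V(1)]
  have W: "{p \<in> topspace ?N. g p \<in> V} \<in> pointclass \<Gamma> ?N" (is "?W \<in> _") .
  define \<nu> where "\<nu> a = Pair a -` ?W" for a
  have "universal_set \<nu> = ?W"
    by (auto simp: universal_set_def \<nu>_def)
  then have "total_representation \<Gamma> X \<nu>"
    using W pointclass_section[OF W] by (auto simp: total_representation_def \<nu>_def)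
  moreover have "tr_reducible \<mu> \<nu>" if \<mu>: "total_representation \<Gamma> X \<mu>" for \<mu>
  proof -
    have \<mu>_in: "universal_set \<mu> \<in> pointclass \<Gamma> ?N" and sub: "\<And>c. \<mu> c \<subseteq> topspace X"
      using \<mu> pointclass_subset[of _ \<Gamma> X] by (auto simp: total_representation_def)
    obtain b where b: "universal_set \<mu> = Pair b -` V"
      using V(2)[OF \<mu>_in] by blast
    \<comment> \<open>Interleaves the fixed \<open>b\<close> with \<open>c\<close>, undoing the
      split in \<open>g\<close>. Each coordinate of the result is a constant or a coordinate of
      \<open>c\<close>.\<close>
    define f :: "(nat \<Rightarrow> nat) \<Rightarrow> nat \<Rightarrow> nat"
      where "f c n = (if even n then b (n div 2) else c (n div 2))" for c n
    have "continuous_map baire baire f"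
    proof (rule continuous_map_into_baire)
      show "continuous_map baire euclidean (\<lambda>c. f c n)" for n
        using continuous_map_baire_coordinate[OF continuous_map_id[unfolded id_def], of "n div 2"]
        by (cases "even n") (simp_all add: f_def)
    qed
    moreover have "\<mu> = \<nu> \<circ> f"
    proof
      fix c
      have "g (f c, x) = (b, c, x)" for x
        by (simp add: g_def f_def)
      \<comment> \<open>\<open>?W\<close> is confined to \<open>topspace ?N\<close>, so the
        identification with \<open>\<mu> c\<close> rests on \<open>sub\<close>.\<close>
      then have "\<nu> (f c) = {x \<in> topspace X. (c, x) \<in> universal_set \<mu>}"
        unfolding b by (auto simp: \<nu>_def)
      then show "\<mu> c = (\<nu> \<circ> f) c"
        using sub by (auto simp: universal_set_def)
    qed
    ultimately show ?thesis unfolding tr_reducible_def by blast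
  qed
  ultimately show ?thesis unfolding principal_total_representation_def by blast
qed

theorem theorem5p2:
  fixes X :: "'a topology" and \<Gamma> :: level
  assumes "second_countable X" and "is_level \<Gamma>"
  shows "\<exists>\<nu>. principal_total_representation \<Gamma> X \<nu>"
  by (intro principal_total_representation_exists has_universal_level second_countable_prod_baire assms)

end
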